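(* For every $\mathbf{a},\mathbf{a}^{*}\in l^{2}$, every $0<\gamma<1$ and every $z\in\mathbb{C}$ one has $$\left\langle e^{zH}\mathbf{a},\mathbf{a}^{*}\right\rangle=\sum_{k\in\mathbb{Z}}\left\langle e^{(\gamma k)H}\mathbf{a},\mathbf{a}^{*}\right\rangle\,\mathrm{sinc}\left(\gamma^{-1}z-k\right),$$ where the series converges uniformly on compact subsets of $\mathbb{R}$.
   Context: $l^{2}$ is the Hilbert space of square-summable complex sequences $\mathbf{a}=(a_n)_{n\in\mathbb{Z}}$ with its natural inner product $\langle\cdot,\cdot\rangle$ (linear in the first argument). $H:l^2\to l^2$ is the bounded operator $H=\pi\widetilde H$, where $\widetilde H$ is the discrete Hilbert transform; explicitly $(H\mathbf{a})_m=\sum_{n\in\mathbb{Z},\,n\neq m}\frac{a_n}{m-n}$, $m\in\mathbb{Z}$. For $z\in\mathbb{C}$, $e^{zH}=\sum_{k=0}^{\infty}\frac{z^kH^k}{k!}$. The function $\mathrm{sinc}$ is the entire function $\mathrm{sinc}(z)=\frac{\sin(\pi z)}{\pi z}$ for $z\neq0$, $\mathrm{sinc}(0)=1$. *)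

theory Defs
  imports "HOL-Analysis.Analysis" "HOL-Real_Asymp.Real_Asymp"
begin

section \<open>The Hilbert space of square-summable sequences indexed by the integers\<close>

definition square_summable :: "(int \<Rightarrow> complex) \<Rightarrow> bool" where
  "square_summable a \<longleftrightarrow> (\<lambda>n. (cmod (a n))\<^sup>2) summable_on UNIV"

lemma cmod_add_sq_le: "(cmod (x + y))\<^sup>2 \<le> 2 * (cmod x)\<^sup>2 + 2 * (cmod y)\<^sup>2"
proof -
  have "(cmod (x + y))\<^sup>2 \<le> (cmod x + cmod y)\<^sup>2"
    by (intro power_mono norm_triangle_ineq) auto
  also have "\<dots> \<le> 2 * (cmod x)\<^sup>2 + 2 * (cmod y)\<^sup>2"
    using sum_squares_bound[of "cmod x" "cmod y"] by (simp add: power2_sum)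
  finally show ?thesis .
qed

lemma square_summable_add:
  assumes "square_summable a" "square_summable b"
  shows "square_summable (\<lambda>n. a n + b n)"
  unfolding square_summable_def
proof (rule summable_on_comparison_test)
  show "(\<lambda>n. 2 * (cmod (a n))\<^sup>2 + 2 * (cmod (b n))\<^sup>2) summable_on UNIV"
    using assms unfolding square_summable_def
    by (intro summable_on_add summable_on_cmult_right)
qed (use cmod_add_sq_le in auto)

lemma square_summable_cmult:
  assumes "square_summable a"
  shows "square_summable (\<lambda>n. c * a n)"
  using assms summable_on_cmult_right[of "\<lambda>n. (cmod (a n))\<^sup>2" UNIV "(cmod c)\<^sup>2"]
  unfolding square_summable_def by (simp add: norm_mult power_mult_distrib)

lemma square_summable_bdd:
  assumes "\<And>F. finite F \<Longrightarrow> (\<Sum>n\<in>F. (cmod (a n))\<^sup>2) \<le> C"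
  shows "square_summable a"
  unfolding square_summable_def
  by (rule nonneg_bdd_above_summable_on) (use assms in \<open>auto intro!: bdd_aboveI2[where M = C]\<close>)

lemma square_summable_mult_abs_summable:
  assumes "square_summable a" "square_summable b"
  shows "(\<lambda>n. cmod (a n * b n)) summable_on UNIV"
proof (rule summable_on_comparison_test)
  show "(\<lambda>n. (cmod (a n))\<^sup>2 + (cmod (b n))\<^sup>2) summable_on UNIV"
    using assms unfolding square_summable_def by (intro summable_on_add)
  show "cmod (a n * b n) \<le> (cmod (a n))\<^sup>2 + (cmod (b n))\<^sup>2" for n
  proof -
    have "0 \<le> cmod (a n) * cmod (b n)" by simp
    with sum_squares_bound[of "cmod (a n)" "cmod (b n)"] show ?thesis
      unfolding norm_mult by linarith
  qed
qed auto

typedef l2 = "{a. square_summable a}"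
  morphisms l2_nth Abs_l2
  by (rule exI[of _ "\<lambda>_. 0"]) (simp add: square_summable_def)

lemma square_summable_l2_nth [simp]: "square_summable (l2_nth a)"
  using l2_nth by auto

lemma l2_eqI: "(\<And>n. l2_nth a n = l2_nth b n) \<Longrightarrow> a = b"
  by (simp add: l2_nth_inject[symmetric] ext)

lemma l2_mult_cnj_abs_summable:
  "(\<lambda>n. cmod (l2_nth a n * cnj (l2_nth b n))) summable_on UNIV"
proof -
  have "square_summable (\<lambda>n. cnj (l2_nth b n))"
    using square_summable_l2_nth[of b] by (simp add: square_summable_def)
  then show ?thesis
    by (intro square_summable_mult_abs_summable) auto
qed

definition l2_cinner :: "l2 \<Rightarrow> l2 \<Rightarrow> complex" where
  "l2_cinner a b = (\<Sum>\<^sub>\<infinity>n. l2_nth a n * cnj (l2_nth b n))"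

lemma l2_cinner_summable: "(\<lambda>n. l2_nth a n * cnj (l2_nth b n)) summable_on UNIV"
  by (rule abs_summable_summable) (rule l2_mult_cnj_abs_summable)

definition l2_cscale :: "complex \<Rightarrow> l2 \<Rightarrow> l2" where
  "l2_cscale c a = Abs_l2 (\<lambda>n. c * l2_nth a n)"

lemma l2_nth_cscale [simp]: "l2_nth (l2_cscale c a) n = c * l2_nth a n"
  by (simp add: l2_cscale_def Abs_l2_inverse square_summable_cmult)

text \<open>
  The library has real inner product spaces only: the real inner product on \<open>l2\<close> is the real part
  of \<^const>\<open>l2_cinner\<close>, so that both induce the same norm (\<open>l2_cinner_self\<close> below).
\<close>

instantiation l2 :: real_inner
begin

definition "0 = Abs_l2 (\<lambda>_. 0)"
definition "a + b = Abs_l2 (\<lambda>n. l2_nth a n + l2_nth b n)" for a b :: l2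
definition "- a = l2_cscale (-1) a" for a :: l2
definition "a - b = a + (- b)" for a b :: l2
definition "r *\<^sub>R a = l2_cscale (of_real r) a" for a :: l2
definition "inner a b = Re (l2_cinner a b)"
definition "norm a = sqrt (inner a a)" for a :: l2
definition "dist a b = norm (a - b)" for a b :: l2
definition "sgn a = inverse (norm a) *\<^sub>R a" for a :: l2
definition "uniformity = (INF e\<in>{0<..}. principal {(x::l2, y). dist x y < e})"
definition "open U \<longleftrightarrow> (\<forall>x\<in>U. eventually (\<lambda>(x', y). x' = x \<longrightarrow> y \<in> U) uniformity)"
  for U :: "l2 set"

lemma l2_nth_zero: "l2_nth 0 n = 0"
  by (simp add: zero_l2_def Abs_l2_inverse square_summable_def)

lemma l2_nth_add: "l2_nth (a + b) n = l2_nth a n + l2_nth b n"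
  by (simp add: plus_l2_def Abs_l2_inverse square_summable_add)

lemma l2_nth_uminus: "l2_nth (- a) n = - l2_nth a n"
  by (simp add: uminus_l2_def)

lemma l2_nth_diff: "l2_nth (a - b) n = l2_nth a n - l2_nth b n"
  by (simp add: minus_l2_def l2_nth_add l2_nth_uminus)

lemma l2_nth_scaleR: "l2_nth (r *\<^sub>R a) n = of_real r * l2_nth a n"
  by (simp add: scaleR_l2_def)

lemmas l2_nth_simps =
  l2_nth_zero l2_nth_add l2_nth_uminus l2_nth_diff l2_nth_scaleR

lemma l2_cinner_self_infsum:
  "l2_cinner a a = of_real (\<Sum>\<^sub>\<infinity>n. (cmod (l2_nth a n))\<^sup>2)"
proof -
  have "((\<lambda>n. (cmod (l2_nth a n))\<^sup>2) has_sum (\<Sum>\<^sub>\<infinity>n. (cmod (l2_nth a n))\<^sup>2)) UNIV"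
    using square_summable_l2_nth[of a] unfolding square_summable_def by simp
  then have "((\<lambda>n. complex_of_real ((cmod (l2_nth a n))\<^sup>2)) has_sum
      of_real (\<Sum>\<^sub>\<infinity>n. (cmod (l2_nth a n))\<^sup>2)) UNIV"
    by (rule has_sum_of_real)
  then show ?thesis
    unfolding l2_cinner_def complex_norm_square by (rule infsumI)
qed

instance
proof
  fix a b c :: l2 and r s :: real
  show "a + b + c = a + (b + c)" "a + b = b + a" "0 + a = a" "- a + a = 0" "a - b = a + - b"
    "r *\<^sub>R (a + b) = r *\<^sub>R a + r *\<^sub>R b" "(r + s) *\<^sub>R a = r *\<^sub>R a + s *\<^sub>R a"
    "r *\<^sub>R s *\<^sub>R a = (r * s) *\<^sub>R a" "1 *\<^sub>R a = a"
    by (auto intro!: l2_eqI simp: l2_nth_simps algebra_simps)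
  show "dist a b = norm (a - b)" "sgn a = inverse (norm a) *\<^sub>R a"
    "norm a = sqrt (inner a a)"
    by (simp_all add: dist_l2_def sgn_l2_def norm_l2_def)
  show "uniformity = (INF e\<in>{0<..}. principal {(x::l2, y). dist x y < e})"
    by (rule uniformity_l2_def)
  show "open U \<longleftrightarrow> (\<forall>x\<in>U. eventually (\<lambda>(x', y). x' = x \<longrightarrow> y \<in> U) uniformity)"
    for U :: "l2 set" by (rule open_l2_def)
  have "l2_cinner a b = cnj (l2_cinner b a)"
    unfolding l2_cinner_def infsum_cnj[symmetric] by (simp add: mult.commute)
  then show "inner a b = inner b a"
    by (simp add: inner_l2_def)
  have "l2_cinner (a + b) c = l2_cinner a c + l2_cinner b c"
    unfolding l2_cinner_def by (simp add: l2_nth_simps distrib_right infsum_add l2_cinner_summable)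
  then show "inner (a + b) c = inner a c + inner b c"
    by (simp add: inner_l2_def)
  have "l2_cinner (r *\<^sub>R a) b = of_real r * l2_cinner a b"
    unfolding l2_cinner_def
    by (simp add: l2_nth_simps mult.assoc infsum_cmult_right l2_cinner_summable)
  then show "inner (r *\<^sub>R a) b = r * inner a b"
    by (simp add: inner_l2_def)
  show "0 \<le> inner a a"
    by (simp add: inner_l2_def l2_cinner_self_infsum infsum_nonneg)
  show "inner a a = 0 \<longleftrightarrow> a = 0"
  proof
    assume "inner a a = 0"
    then have "(\<Sum>\<^sub>\<infinity>n. (cmod (l2_nth a n))\<^sup>2) = 0"
      by (simp add: inner_l2_def l2_cinner_self_infsum)
    then have "(cmod (l2_nth a n))\<^sup>2 = 0" for n
      using nonneg_infsum_le_0D[of "\<lambda>n. (cmod (l2_nth a n))\<^sup>2" UNIV n]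
        square_summable_l2_nth[of a] unfolding square_summable_def by auto
    then show "a = 0"
      by (intro l2_eqI) (simp add: l2_nth_simps)
  qed (simp add: inner_l2_def l2_cinner_self_infsum l2_nth_simps)
qed

end

declare l2_nth_simps [simp]

lemma l2_norm_sq: "(norm a)\<^sup>2 = (\<Sum>\<^sub>\<infinity>n. (cmod (l2_nth a n))\<^sup>2)"
  by (simp add: power2_norm_eq_inner inner_l2_def l2_cinner_self_infsum)

lemma l2_cinner_self: "l2_cinner a a = of_real ((norm a)\<^sup>2)"
  by (simp only: l2_norm_sq l2_cinner_self_infsum)

lemma l2_norm_sq_ge_sum:
  assumes "finite F"
  shows "(\<Sum>n\<in>F. (cmod (l2_nth a n))\<^sup>2) \<le> (norm a)\<^sup>2"
  unfolding l2_norm_sq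
  by (rule finite_sum_le_infsum) (use assms square_summable_l2_nth[of a] in \<open>auto simp: square_summable_def\<close>)

lemma l2_norm_le:
  assumes "\<And>F. finite F \<Longrightarrow> (\<Sum>n\<in>F. (cmod (l2_nth a n))\<^sup>2) \<le> C\<^sup>2" "C \<ge> 0"
  shows "norm a \<le> C"
proof -
  have "(norm a)\<^sup>2 \<le> C\<^sup>2"
    unfolding l2_norm_sq
    by (rule infsum_le_finite_sums)
      (use assms square_summable_l2_nth[of a] in \<open>auto simp: square_summable_def\<close>)
  then show ?thesis
    using assms(2) by (rule power2_le_imp_le)
qed

lemma l2_nth_norm_le: "cmod (l2_nth a n) \<le> norm a"
  using l2_norm_sq_ge_sum[of "{n}" a] by (auto intro: power2_le_imp_le)

instance l2 :: banach
proof
  fix X :: "nat \<Rightarrow> l2"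
  assume X: "Cauchy X"
  have "Cauchy (\<lambda>i. l2_nth (X i) n)" for n
  proof (rule metric_CauchyI)
    fix e :: real assume "e > 0"
    then obtain M where "\<And>i j. i \<ge> M \<Longrightarrow> j \<ge> M \<Longrightarrow> dist (X i) (X j) < e"
      using X by (meson metric_CauchyD)
    moreover have "dist (l2_nth (X i) n) (l2_nth (X j) n) \<le> dist (X i) (X j)" for i j
      using l2_nth_norm_le[of "X i - X j" n] by (simp add: dist_norm)
    ultimately show "\<exists>M. \<forall>i\<ge>M. \<forall>j\<ge>M. dist (l2_nth (X i) n) (l2_nth (X j) n) < e"
      by (meson le_less_trans)
  qed
  then obtain L where L: "\<And>n. (\<lambda>i. l2_nth (X i) n) \<longlonglongrightarrow> L n"
    unfolding Cauchy_convergent_iff convergent_def by metis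
  have bound: "\<exists>M. \<forall>i\<ge>M. \<forall>F. finite F \<longrightarrow> (\<Sum>n\<in>F. (cmod (l2_nth (X i) n - L n))\<^sup>2) \<le> e\<^sup>2"
    if "e > 0" for e
  proof -
    obtain M where M: "\<And>i j. i \<ge> M \<Longrightarrow> j \<ge> M \<Longrightarrow> dist (X i) (X j) < e"
      using X \<open>e > 0\<close> by (meson metric_CauchyD)
    have "(\<Sum>n\<in>F. (cmod (l2_nth (X i) n - L n))\<^sup>2) \<le> e\<^sup>2" if "i \<ge> M" "finite F" for i F
    proof (rule LIMSEQ_le_const2)
      show "(\<lambda>j. \<Sum>n\<in>F. (cmod (l2_nth (X i) n - l2_nth (X j) n))\<^sup>2)
          \<longlonglongrightarrow> (\<Sum>n\<in>F. (cmod (l2_nth (X i) n - L n))\<^sup>2)"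
        by (intro tendsto_intros L)
      have "(\<Sum>n\<in>F. (cmod (l2_nth (X i) n - l2_nth (X j) n))\<^sup>2) \<le> e\<^sup>2" if "j \<ge> M" for j
      proof -
        have "(\<Sum>n\<in>F. (cmod (l2_nth (X i) n - l2_nth (X j) n))\<^sup>2) \<le> (norm (X i - X j))\<^sup>2"
          using l2_norm_sq_ge_sum[OF \<open>finite F\<close>, of "X i - X j"] by simp
        also have "\<dots> \<le> e\<^sup>2"
          using M[OF \<open>i \<ge> M\<close> that] by (intro power_mono) (auto simp: dist_norm)
        finally show ?thesis .
      qed
      then show "\<exists>N. \<forall>j\<ge>N. (\<Sum>n\<in>F. (cmod (l2_nth (X i) n - l2_nth (X j) n))\<^sup>2) \<le> e\<^sup>2"
        by blast
    qed
    then show ?thesis by blast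
  qed
  obtain i0 where "\<And>F. finite F \<Longrightarrow> (\<Sum>n\<in>F. (cmod (l2_nth (X i0) n - L n))\<^sup>2) \<le> 1\<^sup>2"
    using bound[of 1] by auto
  then have "square_summable (\<lambda>n. l2_nth (X i0) n - L n)"
    by (rule square_summable_bdd)
  then have "square_summable (\<lambda>n. l2_nth (X i0) n + (-1) * (l2_nth (X i0) n - L n))"
    by (intro square_summable_add square_summable_cmult) auto
  then have "square_summable L"
    by simp
  then have nth_L: "l2_nth (Abs_l2 L) = L"
    by (simp add: Abs_l2_inverse)
  have "X \<longlonglongrightarrow> Abs_l2 L"
  proof (rule metric_LIMSEQ_I)
    fix e :: real assume "e > 0"
    then obtain M where M: "\<And>i F. i \<ge> M \<Longrightarrow> finite F \<Longrightarrow>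
        (\<Sum>n\<in>F. (cmod (l2_nth (X i) n - L n))\<^sup>2) \<le> (e / 2)\<^sup>2"
      using bound[of "e / 2"] by auto
    have "dist (X i) (Abs_l2 L) < e" if "i \<ge> M" for i
    proof -
      have "norm (X i - Abs_l2 L) \<le> e / 2"
        by (rule l2_norm_le) (use M[OF that] \<open>e > 0\<close> in \<open>auto simp: nth_L\<close>)
      then show ?thesis
        using \<open>e > 0\<close> by (simp add: dist_norm)
    qed
    then show "\<exists>M. \<forall>i\<ge>M. dist (X i) (Abs_l2 L) < e"
      by blast
  qed
  then show "convergent X"
    by (auto simp: convergent_def)
qed

lemma l2_norm_cscale [simp]: "norm (l2_cscale c a) = cmod c * norm a"
proof -
  have "(norm (l2_cscale c a))\<^sup>2 = (cmod c * norm a)\<^sup>2"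
    using square_summable_l2_nth[of a] unfolding square_summable_def
    by (simp add: l2_norm_sq norm_mult power_mult_distrib infsum_cmult_right)
  then show ?thesis
    by (simp add: power2_eq_iff_nonneg)
qed

lemma bounded_linear_l2_cscale: "bounded_linear (l2_cscale c)"
  by (rule bounded_linear_intro[where K = "cmod c"])
    (auto intro!: l2_eqI simp: algebra_simps)

section \<open>Hilbert's inequality and the operator H\<close>

definition hkernel :: "int \<Rightarrow> real" where
  "hkernel d = (if d = 0 then 0 else 1 / of_int d)"

definition hkernel_sq_sum :: real where
  "hkernel_sq_sum = (\<Sum>\<^sub>\<infinity>d. (hkernel d)\<^sup>2)"

lemma hkernel_sq_summable: "(\<lambda>d. (hkernel d)\<^sup>2) summable_on UNIV"
proof -
  have minus: "(hkernel (- d))\<^sup>2 = (hkernel d)\<^sup>2" for d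
    by (simp add: hkernel_def)
  have "summable (\<lambda>n. (hkernel (int n))\<^sup>2)"
    using inverse_power_summable[of 2, where 'a = real]
    by (rule summable_comparison_test'[where N = 0])
      (auto simp: hkernel_def field_simps)
  then have *: "(\<lambda>n. (hkernel (int n))\<^sup>2) summable_on UNIV"
    by (intro summable_nonneg_imp_summable_on) auto
  have "(\<lambda>d. (hkernel d)\<^sup>2) summable_on range int"
    using * by (subst summable_on_reindex) (auto simp: o_def)
  moreover have "(\<lambda>d. (hkernel d)\<^sup>2) summable_on range (\<lambda>n. - int n)"
    using * by (subst summable_on_reindex) (auto simp: o_def inj_def minus)
  moreover have "UNIV = range int \<union> range (\<lambda>n. - int n)"
    by (metis (no_types, lifting) UNIV_eq_I UnI1 UnI2 int_cases2 rangeI)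
  ultimately show ?thesis
    by (metis summable_on_union)
qed

lemma hkernel_sq_sum_bound:
  assumes "finite F" "inj_on g F"
  shows "(\<Sum>m\<in>F. (hkernel (g m))\<^sup>2) \<le> hkernel_sq_sum"
proof -
  have "(\<Sum>m\<in>F. (hkernel (g m))\<^sup>2) = (\<Sum>d\<in>g ` F. (hkernel d)\<^sup>2)"
    using assms by (simp add: sum.reindex)
  also have "\<dots> \<le> hkernel_sq_sum"
    unfolding hkernel_sq_sum_def
    by (rule finite_sum_le_infsum) (use assms hkernel_sq_summable in auto)
  finally show ?thesis .
qed

lemma hkernel_sq_sum_nonneg: "0 \<le> hkernel_sq_sum"
  unfolding hkernel_sq_sum_def by (rule infsum_nonneg) auto

lemma hkernel_symmetric_sum_step:
  "(\<lambda>N. (\<Sum>m\<in>{-int N..int N}. hkernel (m - (d + 1))) - (\<Sum>m\<in>{-int N..int N}. hkernel (m - d)))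
    \<longlonglongrightarrow> 0"
proof -
  have step: "(\<Sum>m\<in>{-int N..int N}. hkernel (m - (d + 1))) - (\<Sum>m\<in>{-int N..int N}. hkernel (m - d))
      = hkernel (- int N - d - 1) - hkernel (int N - d)" for N
  proof -
    have "(\<Sum>m\<in>{-int N..int N}. hkernel (m - (d + 1))) = (\<Sum>m\<in>{-int N-1..int N-1}. hkernel (m - d))"
      by (rule sum.reindex_bij_witness[of _ "\<lambda>m. m + 1" "\<lambda>m. m - 1"]) (auto simp: algebra_simps)
    also have "{-int N-1..int N-1} = insert (-int N-1) {-int N..int N-1}"
      by auto
    also have "(\<Sum>m\<in>\<dots>. hkernel (m - d)) = hkernel (-int N-1-d) + (\<Sum>m\<in>{-int N..int N-1}. hkernel (m - d))"
      by (rule sum.insert) auto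
    finally have 1: "(\<Sum>m\<in>{-int N..int N}. hkernel (m - (d + 1))) =
      hkernel (-int N-1-d) + (\<Sum>m\<in>{-int N..int N-1}. hkernel (m - d))" .
    have "{-int N..int N} = insert (int N) {-int N..int N-1}"
      by auto
    also have "(\<Sum>m\<in>\<dots>. hkernel (m - d)) = hkernel (int N-d) + (\<Sum>m\<in>{-int N..int N-1}. hkernel (m - d))"
      by (rule sum.insert) auto
    finally show ?thesis using 1 by (simp add: algebra_simps)
  qed
  have lim1: "(\<lambda>N. hkernel (- int N - d - 1)) \<longlonglongrightarrow> 0"
  proof (rule Lim_transform_eventually)
    show "(\<lambda>N. 1 / (- real N - of_int d - 1)) \<longlonglongrightarrow> 0"
      by real_asymp
    show "\<forall>\<^sub>F N in sequentially. 1 / (- real N - of_int d - 1) = hkernel (- int N - d - 1)"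
      using eventually_gt_at_top[of "nat \<bar>d\<bar> + 2"]
      by eventually_elim (auto simp: hkernel_def)
  qed
  have lim2: "(\<lambda>N. hkernel (int N - d)) \<longlonglongrightarrow> 0"
  proof (rule Lim_transform_eventually)
    show "(\<lambda>N. 1 / (real N - of_int d)) \<longlonglongrightarrow> 0"
      by real_asymp
    show "\<forall>\<^sub>F N in sequentially. 1 / (real N - of_int d) = hkernel (int N - d)"
      using eventually_gt_at_top[of "nat \<bar>d\<bar> + 2"]
      by eventually_elim (auto simp: hkernel_def)
  qed
  show ?thesis
    unfolding step using tendsto_diff[OF lim1 lim2] by simp
qed

lemma hkernel_symmetric_sum_shift:
  "(\<lambda>N. \<Sum>m\<in>{-int N..int N}. hkernel (m - d)) \<longlonglongrightarrow> 0"
proof (induction d rule: int_induct[where k = 0])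
  case base
  have "(\<Sum>m\<in>{-int N..int N}. hkernel m) = (\<Sum>m\<in>{-int N..int N}. hkernel (- m))" for N
    by (rule sum.reindex_bij_witness[of _ uminus uminus]) auto
  moreover have "(\<Sum>m\<in>{-int N..int N}. hkernel (- m)) = - (\<Sum>m\<in>{-int N..int N}. hkernel m)" for N
    unfolding sum_negf[symmetric] by (rule sum.cong) (auto simp: hkernel_def)
  ultimately have "(\<Sum>m\<in>{-int N..int N}. hkernel m) = 0" for N
    by (smt (verit))
  then show ?case by simp
next
  case (step1 d)
  show ?case
    using tendsto_add[OF hkernel_symmetric_sum_step[of d] step1(2)] by simp
next
  case (step2 d)
  show ?case
    using tendsto_diff[OF step2(2) hkernel_symmetric_sum_step[of "d - 1"]] by simp
qed

lemma hkernel_mult: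
  assumes "n \<noteq> k"
  shows "hkernel (m - n) * hkernel (m - k) =
    hkernel (n - k) * (hkernel (m - n) - hkernel (m - k)) +
    (hkernel (n - k))\<^sup>2 * ((if m = n then 1 else 0) + (if m = k then 1 else 0))"
proof -
  consider "m = n" | "m = k" | "m \<noteq> n" "m \<noteq> k" by blast
  then show ?thesis
  proof cases
    case 3
    then show ?thesis
      using assms by (simp add: hkernel_def divide_simps)
  qed (use assms in \<open>auto simp: hkernel_def divide_simps power2_eq_square\<close>)
qed

lemma hkernel_mult_sum_tendsto:
  assumes "n \<noteq> k"
  shows "(\<lambda>N. \<Sum>m\<in>{-int N..int N}. hkernel (m - n) * hkernel (m - k))
    \<longlonglongrightarrow> 2 * (hkernel (n - k))\<^sup>2"
proof (rule Lim_transform_eventually)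
  let ?S = "\<lambda>d N. \<Sum>m\<in>{-int N..int N}. hkernel (m - d)"
  show "(\<lambda>N. hkernel (n - k) * (?S n N - ?S k N) + (hkernel (n - k))\<^sup>2 * (1 + 1))
      \<longlonglongrightarrow> 2 * (hkernel (n - k))\<^sup>2"
    by (rule tendsto_eq_intros hkernel_symmetric_sum_shift refl | simp)+
  show "\<forall>\<^sub>F N in sequentially. hkernel (n - k) * (?S n N - ?S k N) + (hkernel (n - k))\<^sup>2 * (1 + 1) =
      (\<Sum>m\<in>{-int N..int N}. hkernel (m - n) * hkernel (m - k))"
    using eventually_gt_at_top[of "nat (max \<bar>n\<bar> \<bar>k\<bar>)"]
  proof eventually_elim
    case (elim N)
    then have "n \<in> {-int N..int N}" "k \<in> {-int N..int N}" by auto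
    then show ?case
      unfolding hkernel_mult[OF assms]
      by (simp only: sum.distrib sum_distrib_left[symmetric] sum_subtractf sum.delta finite_atLeastAtMost_int if_True)
  qed
qed

lemma hilbert_inequality_real:
  fixes x :: "int \<Rightarrow> real"
  assumes "finite F" "finite G"
  shows "(\<Sum>m\<in>F. (\<Sum>n\<in>G. x n * hkernel (m - n))\<^sup>2) \<le> 3 * hkernel_sq_sum * (\<Sum>n\<in>G. (x n)\<^sup>2)"
proof -
  let ?I = "\<lambda>N. {-int N..int N}"
  let ?S = "\<lambda>n k N. \<Sum>m\<in>?I N. hkernel (m - n) * hkernel (m - k)"
  let ?D = "\<Sum>n\<in>G. (x n)\<^sup>2"
  define U where "U N = hkernel_sq_sum * ?D + (\<Sum>n\<in>G. \<Sum>k\<in>G-{n}. x n * x k * ?S n k N)" for N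
  define L where "L = hkernel_sq_sum * ?D + (\<Sum>n\<in>G. \<Sum>k\<in>G-{n}. x n * x k * (2 * (hkernel (n - k))\<^sup>2))"
  have "U \<longlonglongrightarrow> L"
    unfolding U_def L_def
    by (intro tendsto_intros hkernel_mult_sum_tendsto) auto
  moreover have "\<forall>\<^sub>F N in sequentially. (\<Sum>m\<in>F. (\<Sum>n\<in>G. x n * hkernel (m - n))\<^sup>2) \<le> U N"
    using eventually_ge_at_top[of "\<Sum>m\<in>F. nat \<bar>m\<bar>"]
  proof eventually_elim
    case (elim N)
    have "F \<subseteq> ?I N"
    proof
      fix m assume "m \<in> F"
      then have "nat \<bar>m\<bar> \<le> (\<Sum>m\<in>F. nat \<bar>m\<bar>)"
        using assms by (intro member_le_sum) auto
      then show "m \<in> ?I N" using elim by auto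
    qed
    then have "(\<Sum>m\<in>F. (\<Sum>n\<in>G. x n * hkernel (m - n))\<^sup>2)
        \<le> (\<Sum>m\<in>?I N. (\<Sum>n\<in>G. x n * hkernel (m - n))\<^sup>2)"
      by (intro sum_mono2) auto
    also have "\<dots> = (\<Sum>m\<in>?I N. \<Sum>n\<in>G. \<Sum>k\<in>G. x n * x k * (hkernel (m - n) * hkernel (m - k)))"
      by (simp add: power2_eq_square sum_product mult_ac)
    also have "\<dots> = (\<Sum>n\<in>G. \<Sum>k\<in>G. x n * x k * ?S n k N)"
      by (subst sum.swap, rule sum.cong[OF refl], subst sum.swap)
        (simp add: sum_distrib_left)
    also have "\<dots> = (\<Sum>n\<in>G. x n * x n * ?S n n N + (\<Sum>k\<in>G-{n}. x n * x k * ?S n k N))"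
      using assms by (intro sum.cong refl sum.remove) auto
    also have "\<dots> \<le> (\<Sum>n\<in>G. hkernel_sq_sum * (x n)\<^sup>2 + (\<Sum>k\<in>G-{n}. x n * x k * ?S n k N))"
    proof (intro sum_mono add_right_mono)
      fix n
      have "?S n n N \<le> hkernel_sq_sum"
        using hkernel_sq_sum_bound[of "?I N" "\<lambda>m. m - n"] by (simp add: power2_eq_square inj_on_def)
      then have "(x n)\<^sup>2 * ?S n n N \<le> (x n)\<^sup>2 * hkernel_sq_sum"
        by (intro mult_left_mono) auto
      then show "x n * x n * ?S n n N \<le> hkernel_sq_sum * (x n)\<^sup>2"
        by (simp add: power2_eq_square mult_ac)
    qed
    also have "\<dots> = U N"
      by (simp add: U_def sum.distrib sum_distrib_left)
    finally show ?case .
  qed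
  ultimately have "(\<Sum>m\<in>F. (\<Sum>n\<in>G. x n * hkernel (m - n))\<^sup>2) \<le> L"
    by (rule tendsto_lowerbound) auto
  also have "L \<le> 3 * hkernel_sq_sum * ?D"
  proof -
    have "(\<Sum>n\<in>G. \<Sum>k\<in>G-{n}. x n * x k * (2 * (hkernel (n - k))\<^sup>2))
        \<le> (\<Sum>n\<in>G. \<Sum>k\<in>G-{n}. (x n)\<^sup>2 * (hkernel (n - k))\<^sup>2 + (x k)\<^sup>2 * (hkernel (n - k))\<^sup>2)"
    proof (intro sum_mono)
      fix n k
      have "2 * x n * x k * (hkernel (n - k))\<^sup>2 \<le> ((x n)\<^sup>2 + (x k)\<^sup>2) * (hkernel (n - k))\<^sup>2"
        by (intro mult_right_mono sum_squares_bound) auto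
      then show "x n * x k * (2 * (hkernel (n - k))\<^sup>2)
          \<le> (x n)\<^sup>2 * (hkernel (n - k))\<^sup>2 + (x k)\<^sup>2 * (hkernel (n - k))\<^sup>2"
        by (simp add: algebra_simps)
    qed
    also have "\<dots> \<le> (\<Sum>n\<in>G. \<Sum>k\<in>G. (x n)\<^sup>2 * (hkernel (n - k))\<^sup>2 + (x k)\<^sup>2 * (hkernel (n - k))\<^sup>2)"
      using assms by (intro sum_mono sum_mono2) auto
    also have "\<dots> = (\<Sum>n\<in>G. (x n)\<^sup>2 * (\<Sum>k\<in>G. (hkernel (n - k))\<^sup>2))
        + (\<Sum>k\<in>G. (x k)\<^sup>2 * (\<Sum>n\<in>G. (hkernel (n - k))\<^sup>2))"
      unfolding sum.distrib sum_distrib_left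
      using sum.swap[of "\<lambda>n k. (x k)\<^sup>2 * (hkernel (n - k))\<^sup>2" G G] by simp
    also have "\<dots> \<le> (\<Sum>n\<in>G. (x n)\<^sup>2 * hkernel_sq_sum) + (\<Sum>k\<in>G. (x k)\<^sup>2 * hkernel_sq_sum)"
      using assms
      by (intro add_mono sum_mono mult_left_mono hkernel_sq_sum_bound) (auto simp: inj_on_def)
    finally show ?thesis
      by (simp add: L_def sum_distrib_left[symmetric] sum_distrib_right[symmetric] mult_ac)
  qed
  finally show ?thesis .
qed

lemma hilbert_inequality_finite:
  assumes "finite F" "finite G"
  shows "(\<Sum>m\<in>F. (cmod (\<Sum>n\<in>G. a n * of_real (hkernel (m - n))))\<^sup>2)
    \<le> 3 * hkernel_sq_sum * (\<Sum>n\<in>G. (cmod (a n))\<^sup>2)"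
  using hilbert_inequality_real[OF assms, of "\<lambda>n. Re (a n)"]
    hilbert_inequality_real[OF assms, of "\<lambda>n. Im (a n)"]
  by (simp add: cmod_power2 sum.distrib distrib_left)

definition hilbert_seq :: "(int \<Rightarrow> complex) \<Rightarrow> int \<Rightarrow> complex" where
  "hilbert_seq a m = (\<Sum>\<^sub>\<infinity>n\<in>{n. n \<noteq> m}. a n / of_int (m - n))"

lemma hilbert_seq_has_sum:
  assumes "square_summable a"
  shows "((\<lambda>n. a n * of_real (hkernel (m - n))) has_sum hilbert_seq a m) UNIV"
proof -
  have "square_summable (\<lambda>n. of_real (hkernel (m - n)))"
    by (rule square_summable_bdd[of _ hkernel_sq_sum])
      (auto intro!: hkernel_sq_sum_bound simp: inj_on_def)
  then have "(\<lambda>n. a n * of_real (hkernel (m - n))) summable_on UNIV"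
    using assms abs_summable_summable[OF square_summable_mult_abs_summable] by blast
  moreover have "hilbert_seq a m = (\<Sum>\<^sub>\<infinity>n. a n * of_real (hkernel (m - n)))"
    unfolding hilbert_seq_def by (rule infsum_cong_neutral) (auto simp: hkernel_def)
  ultimately show ?thesis by simp
qed

lemma hilbert_seq_sum_le:
  assumes "finite F"
  shows "(\<Sum>m\<in>F. (cmod (hilbert_seq (l2_nth a) m))\<^sup>2) \<le> 3 * hkernel_sq_sum * (norm a)\<^sup>2"
proof (rule tendsto_upperbound)
  show "((\<lambda>G. \<Sum>m\<in>F. (cmod (\<Sum>n\<in>G. l2_nth a n * of_real (hkernel (m - n))))\<^sup>2) \<longlongrightarrow>
      (\<Sum>m\<in>F. (cmod (hilbert_seq (l2_nth a) m))\<^sup>2)) (finite_subsets_at_top UNIV)"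
    using hilbert_seq_has_sum[OF square_summable_l2_nth[of a]]
    by (intro tendsto_intros) (simp add: has_sum_def)
  show "\<forall>\<^sub>F G in finite_subsets_at_top UNIV.
      (\<Sum>m\<in>F. (cmod (\<Sum>n\<in>G. l2_nth a n * of_real (hkernel (m - n))))\<^sup>2)
      \<le> 3 * hkernel_sq_sum * (norm a)\<^sup>2"
  proof (rule eventually_finite_subsets_at_top_weakI)
    fix G :: "int set" assume G: "finite G"
    have "(\<Sum>m\<in>F. (cmod (\<Sum>n\<in>G. l2_nth a n * of_real (hkernel (m - n))))\<^sup>2)
        \<le> 3 * hkernel_sq_sum * (\<Sum>n\<in>G. (cmod (l2_nth a n))\<^sup>2)"
      by (rule hilbert_inequality_finite[OF assms G])
    also have "\<dots> \<le> 3 * hkernel_sq_sum * (norm a)\<^sup>2"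
      using G hkernel_sq_sum_nonneg by (intro mult_left_mono l2_norm_sq_ge_sum) auto
    finally show "(\<Sum>m\<in>F. (cmod (\<Sum>n\<in>G. l2_nth a n * of_real (hkernel (m - n))))\<^sup>2)
        \<le> 3 * hkernel_sq_sum * (norm a)\<^sup>2" .
  qed
qed auto

lemma square_summable_hilbert_seq: "square_summable (hilbert_seq (l2_nth a))"
  by (rule square_summable_bdd) (rule hilbert_seq_sum_le)

lemma bounded_linear_hilbert: "bounded_linear (\<lambda>a. Abs_l2 (hilbert_seq (l2_nth a)))"
proof (rule bounded_linear_intro)
  have nth: "l2_nth (Abs_l2 (hilbert_seq (l2_nth a))) = hilbert_seq (l2_nth a)" for a
    by (simp add: Abs_l2_inverse square_summable_hilbert_seq)
  note has_sum = hilbert_seq_has_sum[OF square_summable_l2_nth]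
  show "Abs_l2 (hilbert_seq (l2_nth (a + b))) =
      Abs_l2 (hilbert_seq (l2_nth a)) + Abs_l2 (hilbert_seq (l2_nth b))" for a b
  proof (rule l2_eqI)
    fix m
    have "((\<lambda>n. l2_nth (a + b) n * of_real (hkernel (m - n))) has_sum
        (hilbert_seq (l2_nth a) m + hilbert_seq (l2_nth b) m)) UNIV"
      using has_sum_add[OF has_sum[of a m] has_sum[of b m]] by (simp add: distrib_right)
    then show "l2_nth (Abs_l2 (hilbert_seq (l2_nth (a + b)))) m =
        l2_nth (Abs_l2 (hilbert_seq (l2_nth a)) + Abs_l2 (hilbert_seq (l2_nth b))) m"
      using has_sum[of "a + b" m] by (simp add: nth has_sum_unique)
  qed
  show "Abs_l2 (hilbert_seq (l2_nth (r *\<^sub>R a))) = r *\<^sub>R Abs_l2 (hilbert_seq (l2_nth a))" for r a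
  proof (rule l2_eqI)
    fix m
    have "((\<lambda>n. l2_nth (r *\<^sub>R a) n * of_real (hkernel (m - n))) has_sum
        (of_real r * hilbert_seq (l2_nth a) m)) UNIV"
      using has_sum_cmult_right[OF has_sum[of a m], of "of_real r"] by (simp add: mult.assoc)
    then show "l2_nth (Abs_l2 (hilbert_seq (l2_nth (r *\<^sub>R a)))) m =
        l2_nth (r *\<^sub>R Abs_l2 (hilbert_seq (l2_nth a))) m"
      using has_sum[of "r *\<^sub>R a" m] by (simp add: nth has_sum_unique)
  qed
  show "norm (Abs_l2 (hilbert_seq (l2_nth a))) \<le> norm a * sqrt (3 * hkernel_sq_sum)" for a
  proof (rule l2_norm_le)
    have "(norm a * sqrt (3 * hkernel_sq_sum))\<^sup>2 = 3 * hkernel_sq_sum * (norm a)\<^sup>2"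
      using hkernel_sq_sum_nonneg by (simp add: power_mult_distrib)
    then show "(\<Sum>n\<in>F. (cmod (l2_nth (Abs_l2 (hilbert_seq (l2_nth a))) n))\<^sup>2)
        \<le> (norm a * sqrt (3 * hkernel_sq_sum))\<^sup>2" if "finite F" for F
      using hilbert_seq_sum_le[OF that, of a] unfolding nth by simp
    show "0 \<le> norm a * sqrt (3 * hkernel_sq_sum)"
      using hkernel_sq_sum_nonneg by simp
  qed
qed

definition hilbert_op :: "l2 \<Rightarrow>\<^sub>L l2" where
  "hilbert_op = Blinfun (\<lambda>a. Abs_l2 (hilbert_seq (l2_nth a)))"

lemma l2_nth_hilbert_op:
  "l2_nth (hilbert_op a) m = (\<Sum>\<^sub>\<infinity>n\<in>{n. n \<noteq> m}. l2_nth a n / of_int (m - n))"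
  by (simp add: hilbert_op_def bounded_linear_Blinfun_apply[OF bounded_linear_hilbert]
      Abs_l2_inverse square_summable_hilbert_seq hilbert_seq_def)

section \<open>The operator exponential\<close>

text \<open>
  \<open>l2 \<Rightarrow>\<^sub>L l2\<close> consists of the bounded \<^emph>\<open>real\<close>-linear operators and carries only a real vector space
  structure, hence the separate complex scalar multiple.
\<close>

definition op_cscale :: "complex \<Rightarrow> (l2 \<Rightarrow>\<^sub>L l2) \<Rightarrow> (l2 \<Rightarrow>\<^sub>L l2)" where
  "op_cscale c T = Blinfun (l2_cscale c) o\<^sub>L T"

definition op_power :: "(l2 \<Rightarrow>\<^sub>L l2) \<Rightarrow> nat \<Rightarrow> (l2 \<Rightarrow>\<^sub>L l2)" where
  "op_power T k = ((\<lambda>S. T o\<^sub>L S) ^^ k) id_blinfun"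

text \<open>The series converges in operator norm (\<open>op_exp_summable\<close> below).\<close>

definition op_exp :: "complex \<Rightarrow> (l2 \<Rightarrow>\<^sub>L l2) \<Rightarrow> (l2 \<Rightarrow>\<^sub>L l2)" where
  "op_exp z T = (\<Sum>k. op_cscale (z ^ k / fact k) (op_power T k))"

lemma op_cscale_apply: "op_cscale c T a = l2_cscale c (T a)"
  by (simp add: op_cscale_def bounded_linear_Blinfun_apply[OF bounded_linear_l2_cscale])

lemma op_exp_summable: "summable (\<lambda>k. op_cscale (z ^ k / fact k) (op_power T k))"
proof (rule summable_comparison_test'[where N = 0])
  have power: "norm (op_power T k) \<le> norm T ^ k" for k
  proof (induction k)
    case 0
    show ?case by (simp add: op_power_def norm_blinfun_id_le)
  next
    case (Suc k)
    have "norm (op_power T (Suc k)) \<le> norm T * norm (op_power T k)"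
      by (simp add: op_power_def norm_blinfun_compose)
    also have "\<dots> \<le> norm T * norm T ^ k"
      by (intro mult_left_mono Suc.IH) auto
    finally show ?case by simp
  qed
  show "norm (op_cscale (z ^ k / fact k) (op_power T k)) \<le> inverse (fact k) * (cmod z * norm T) ^ k" for k
  proof (rule norm_blinfun_bound)
    fix a
    have "norm (op_cscale (z ^ k / fact k) (op_power T k) a) =
        inverse (fact k) * cmod z ^ k * norm (op_power T k a)"
      by (simp add: op_cscale_apply norm_mult norm_inverse norm_power divide_inverse mult_ac)
    also have "norm (op_power T k a) \<le> norm T ^ k * norm a"
      using norm_blinfun[of "op_power T k" a] power[of k]
      by (meson mult_right_mono norm_ge_zero order_trans)
    then have "inverse (fact k) * cmod z ^ k * norm (op_power T k a)
        \<le> inverse (fact k) * cmod z ^ k * (norm T ^ k * norm a)"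
      by (intro mult_left_mono) auto
    finally show "norm (op_cscale (z ^ k / fact k) (op_power T k) a)
        \<le> inverse (fact k) * (cmod z * norm T) ^ k * norm a"
      by (simp add: power_mult_distrib mult_ac)
  qed auto
  show "summable (\<lambda>k. inverse (fact k) * (cmod z * norm T) ^ k)"
    by (rule summable_exp)
qed

section \<open>The cardinal sine\<close>

definition csinc :: "complex \<Rightarrow> complex" where
  "csinc z = (if z = 0 then 1 else sin (of_real pi * z) / (of_real pi * z))"

end

theory Submission
  imports Defs "HOL-Complex_Analysis.Residue_Theorem"
begin

text \<open>
  The operator \<open>H\<close> is skew-adjoint with norm at most \<open>pi\<close>, so \<open>exp (x H)\<close> is an isometry for real
  \<open>x\<close> and every matrix coefficient \<open>f z = \<langle>exp (z H) a, a'\<rangle>\<close> is an entire function with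
  \<open>\<bar>f z\<bar> \<le> \<parallel>a\<parallel> * \<parallel>a'\<parallel> * exp (pi * \<bar>Im z\<bar>)\<close> (\<open>norm_hilbert_exp_coeff_le\<close>). Rescaling gives
  \<open>F w = f (\<gamma> * w)\<close>, which is bounded on the real line and of exponential type \<open>\<gamma> * pi\<close>, strictly
  below \<open>pi\<close>. Such a function is the sum of its cardinal series: this is the sampling theorem for
  bandlimited functions, with strict oversampling (\<open>cardinal_series_uniform_limit\<close>).

  The growth bound rests on \<open>\<parallel>exp (z H) a\<parallel>\<^sup>2 = \<langle>exp ((z - cnj z) H) a, a\<rangle>\<close>, in which only \<open>Im z\<close>
  remains. The sampling theorem is a residue computation (\<open>cardinal_series_remainder_le\<close>): the difference
  between \<open>F z\<close> and a partial sum is \<open>sin (pi * z) / (2 * pi * \<i>)\<close> times the integral of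
  \<open>F w / ((w - z) * sin (pi * w))\<close> over a large rectangle. The strict inequality \<open>\<gamma> < 1\<close> makes the
  integrand decay exponentially away from the real axis, so that the integral tends to zero as the two
  vertical sides recede, independently of each other.
\<close>

section \<open>The complex inner product\<close>

lemma has_sum_l2_cinner:
  "((\<lambda>n. l2_nth a n * cnj (l2_nth b n)) has_sum l2_cinner a b) UNIV"
  unfolding l2_cinner_def by (rule has_sum_infsum[OF l2_cinner_summable])

lemma l2_cinner_add_left: "l2_cinner (a + b) c = l2_cinner a c + l2_cinner b c"
  using has_sum_add[OF has_sum_l2_cinner[of a c] has_sum_l2_cinner[of b c]]
  by (intro has_sum_unique[OF has_sum_l2_cinner]) (simp add: algebra_simps)

lemma l2_cinner_cscale_left: "l2_cinner (l2_cscale r a) b = r * l2_cinner a b"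
  using has_sum_cmult_right[OF has_sum_l2_cinner[of a b], of r]
  by (intro has_sum_unique[OF has_sum_l2_cinner]) (simp add: mult.assoc)

lemma cnj_l2_cinner: "cnj (l2_cinner a b) = l2_cinner b a"
  using has_sum_l2_cinner[of a b]
  by (subst (asm) has_sum_cnj_iff[symmetric])
    (auto intro!: has_sum_unique[OF _ has_sum_l2_cinner] simp: mult.commute)

text \<open>
  Rotating \<open>a\<close> by a unimodular scalar makes the complex inner product real and nonnegative; it then
  equals the real inner product, to which the inequality of real inner product spaces applies.
\<close>

lemma l2_cinner_Cauchy_Schwarz: "cmod (l2_cinner a b) \<le> norm a * norm b"
proof (cases "l2_cinner a b = 0")
  case False
  define u where "u = cnj (sgn (l2_cinner a b))"
  have [simp]: "cmod u = 1"
    using False by (simp add: u_def norm_sgn)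
  have "u * l2_cinner a b = of_real (cmod (l2_cinner a b))"
    using False complex_norm_square[of "l2_cinner a b"]
    by (simp add: u_def sgn_eq field_simps power2_eq_square)
  then have "cmod (l2_cinner a b) = inner (l2_cscale u a) b"
    by (simp add: inner_l2_def l2_cinner_cscale_left)
  also have "\<dots> \<le> norm (l2_cscale u a) * norm b"
    by (rule norm_cauchy_schwarz)
  finally show ?thesis by simp
qed auto

lemma bounded_linear_l2_cinner_left: "bounded_linear (\<lambda>a. l2_cinner a b)"
proof (rule bounded_linear_intro[where K = "norm b"])
  show "l2_cinner (r *\<^sub>R a) b = r *\<^sub>R l2_cinner a b" for r a
    by (simp add: scaleR_l2_def l2_cinner_cscale_left scaleR_conv_of_real)
qed (auto simp: l2_cinner_add_left l2_cinner_Cauchy_Schwarz)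

section \<open>H is skew-adjoint and has norm at most pi\<close>

definition l2_restrict :: "int set \<Rightarrow> l2 \<Rightarrow> l2" where
  "l2_restrict F a = Abs_l2 (\<lambda>n. if n \<in> F then l2_nth a n else 0)"

lemma l2_nth_restrict: "l2_nth (l2_restrict F a) n = (if n \<in> F then l2_nth a n else 0)"
proof -
  have "square_summable (\<lambda>n. if n \<in> F then l2_nth a n else 0)"
    unfolding square_summable_def
    by (rule summable_on_comparison_test[of "\<lambda>n. (cmod (l2_nth a n))\<^sup>2"])
      (use square_summable_l2_nth[of a] in \<open>auto simp: square_summable_def\<close>)
  then show ?thesis
    by (simp add: l2_restrict_def Abs_l2_inverse)
qed

lemma l2_restrict_tendsto:
  "((\<lambda>F. l2_restrict F a) \<longlongrightarrow> a) (finite_subsets_at_top UNIV)"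
proof -
  let ?q = "\<lambda>n. (cmod (l2_nth a n))\<^sup>2"
  have q: "(?q has_sum (norm a)\<^sup>2) UNIV"
    using square_summable_l2_nth[of a] by (simp add: l2_norm_sq square_summable_def)
  have dist: "(norm (a - l2_restrict F a))\<^sup>2 = (norm a)\<^sup>2 - sum ?q F" if "finite F" for F
  proof -
    have "((\<lambda>n. - (if n \<in> F then ?q n else 0)) has_sum - sum ?q F) UNIV"
      using that by (intro has_sum_finite_neutralI[of F]) (auto simp: sum_negf)
    from has_sum_add[OF q this]
    have "((\<lambda>n. ?q n - (if n \<in> F then ?q n else 0)) has_sum (norm a)\<^sup>2 - sum ?q F) UNIV"
      by simp
    moreover have "?q n - (if n \<in> F then ?q n else 0) = (cmod (l2_nth (a - l2_restrict F a) n))\<^sup>2"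
      for n by (simp add: l2_nth_restrict)
    ultimately show ?thesis
      by (simp only: l2_norm_sq infsumI)
  qed
  have "((\<lambda>F. (norm a)\<^sup>2 - sum ?q F) \<longlongrightarrow> (norm a)\<^sup>2 - (norm a)\<^sup>2) (finite_subsets_at_top UNIV)"
    using q unfolding has_sum_def by (intro tendsto_diff tendsto_const)
  then have "((\<lambda>F. (norm a)\<^sup>2 - sum ?q F) \<longlongrightarrow> 0) (finite_subsets_at_top UNIV)"
    by simp
  then have "((\<lambda>F. (norm (a - l2_restrict F a))\<^sup>2) \<longlongrightarrow> 0) (finite_subsets_at_top UNIV)"
    by (rule Lim_transform_eventually)
      (auto intro!: eventually_finite_subsets_at_top_weakI simp: dist)
  then have "((\<lambda>F. a - l2_restrict F a) \<longlongrightarrow> 0) (finite_subsets_at_top UNIV)"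
    by (auto simp: tendsto_norm_zero_iff dest: tendsto_real_sqrt)
  then have "((\<lambda>F. a - (a - l2_restrict F a)) \<longlongrightarrow> a - 0) (finite_subsets_at_top UNIV)"
    by (intro tendsto_diff tendsto_const)
  then show ?thesis by simp
qed

lemma hilbert_op_has_sum:
  "((\<lambda>n. l2_nth a n * of_real (hkernel (m - n))) has_sum l2_nth (hilbert_op a) m) UNIV"
  using hilbert_seq_has_sum[OF square_summable_l2_nth[of a], of m]
  by (simp add: l2_nth_hilbert_op hilbert_seq_def)

text \<open>
  The kernel \<open>1 / (m - n)\<close> is real and antisymmetric, so the identity is an exchange of two sums. The
  double sum need not converge absolutely, so the exchange is made for finitely supported \<open>a\<close> only, and
  then extended by density and continuity.
\<close>

lemma hilbert_op_skew_adjoint: "l2_cinner (hilbert_op a) b = - l2_cinner a (hilbert_op b)"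
proof -
  have fin: "l2_cinner (hilbert_op (l2_restrict F a)) b = - l2_cinner (l2_restrict F a) (hilbert_op b)"
    if "finite F" for F
  proof -
    have 1: "l2_nth (hilbert_op (l2_restrict F a)) m = (\<Sum>n\<in>F. l2_nth a n * of_real (hkernel (m - n)))"
      for m
      by (rule has_sum_unique[OF hilbert_op_has_sum], rule has_sum_finite_neutralI[of F])
        (use that in \<open>auto simp: l2_nth_restrict\<close>)
    have 2: "((\<lambda>m. l2_nth a n * of_real (hkernel (m - n)) * cnj (l2_nth b m)) has_sum
        - (l2_nth a n * cnj (l2_nth (hilbert_op b) n))) UNIV" for n
    proof -
      have "hkernel (m - n) = - hkernel (n - m)" for m
        by (auto simp: hkernel_def divide_simps)
      moreover have "((\<lambda>m. cnj (l2_nth b m * of_real (hkernel (n - m)))) has_sum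
          cnj (l2_nth (hilbert_op b) n)) UNIV"
        using hilbert_op_has_sum by (subst has_sum_cnj_iff)
      then have "((\<lambda>m. - l2_nth a n * cnj (l2_nth b m * of_real (hkernel (n - m)))) has_sum
          - l2_nth a n * cnj (l2_nth (hilbert_op b) n)) UNIV"
        by (rule has_sum_cmult_right)
      ultimately show ?thesis by (simp add: mult_ac)
    qed
    have "((\<lambda>m. \<Sum>n\<in>F. l2_nth a n * of_real (hkernel (m - n)) * cnj (l2_nth b m)) has_sum
        (\<Sum>n\<in>F. - (l2_nth a n * cnj (l2_nth (hilbert_op b) n)))) UNIV"
      using that
    proof (induction F rule: finite_induct)
      case (insert n F)
      then show ?case using has_sum_add[OF 2[of n] insert.IH] by simp
    qed simp
    then have "((\<lambda>m. l2_nth (hilbert_op (l2_restrict F a)) m * cnj (l2_nth b m)) has_sum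
        (\<Sum>n\<in>F. - (l2_nth a n * cnj (l2_nth (hilbert_op b) n)))) UNIV"
      by (simp add: 1 sum_distrib_right)
    then have "l2_cinner (hilbert_op (l2_restrict F a)) b =
        - (\<Sum>n\<in>F. l2_nth a n * cnj (l2_nth (hilbert_op b) n))"
      by (simp add: has_sum_unique[OF has_sum_l2_cinner] sum_negf)
    also have "(\<Sum>n\<in>F. l2_nth a n * cnj (l2_nth (hilbert_op b) n)) =
        l2_cinner (l2_restrict F a) (hilbert_op b)"
      by (rule has_sum_unique[OF _ has_sum_l2_cinner], rule has_sum_finite_neutralI[of F])
        (use that in \<open>auto simp: l2_nth_restrict\<close>)
    finally show ?thesis .
  qed
  let ?T = "finite_subsets_at_top (UNIV :: int set)"
  have L: "((\<lambda>F. l2_cinner (hilbert_op (l2_restrict F a)) b) \<longlongrightarrow> l2_cinner (hilbert_op a) b) ?T"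
    by (intro bounded_linear.tendsto[OF bounded_linear_l2_cinner_left]
        bounded_linear.tendsto[OF blinfun.bounded_linear_right] l2_restrict_tendsto)
  have R: "((\<lambda>F. - l2_cinner (l2_restrict F a) (hilbert_op b)) \<longlongrightarrow> - l2_cinner a (hilbert_op b)) ?T"
    by (intro tendsto_minus bounded_linear.tendsto[OF bounded_linear_l2_cinner_left] l2_restrict_tendsto)
  have "((\<lambda>F. l2_cinner (hilbert_op (l2_restrict F a)) b) \<longlongrightarrow> - l2_cinner a (hilbert_op b)) ?T"
    using R by (rule Lim_transform_eventually)
      (auto intro!: eventually_finite_subsets_at_top_weakI simp: fin)
  with L show ?thesis
    by (rule tendsto_unique[rotated]) simp
qed

lemma hkernel_sq_sum_eq: "hkernel_sq_sum = pi\<^sup>2 / 3"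
proof -
  have "((\<lambda>n. (hkernel (int n + 1))\<^sup>2) has_sum pi\<^sup>2 / 6) UNIV"
    using inverse_squares_sums
    by (intro sums_nonneg_imp_has_sum) (auto simp: hkernel_def power_divide add.commute)
  then have half: "((\<lambda>d. (hkernel d)\<^sup>2) has_sum pi\<^sup>2 / 6) {1..}"
    by (rule has_sum_reindex_bij_witness[of _ "\<lambda>d. nat (d - 1)" "\<lambda>n. int n + 1", THEN iffD1, rotated -1])
      auto
  then have "((\<lambda>d. (hkernel d)\<^sup>2) has_sum pi\<^sup>2 / 6) {..-1}"
    by (rule has_sum_reindex_bij_witness[of _ uminus uminus, THEN iffD1, rotated -1])
      (auto simp: hkernel_def)
  moreover have "{1..} \<inter> {..-1::int} = {}"
    by auto
  ultimately have "((\<lambda>d. (hkernel d)\<^sup>2) has_sum pi\<^sup>2 / 3) ({1..} \<union> {..-1})"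
    using has_sum_Un_disjoint[OF half] by fastforce
  then have "((\<lambda>d. (hkernel d)\<^sup>2) has_sum pi\<^sup>2 / 3) UNIV"
    by (rule has_sum_cong_neutral[THEN iffD1, rotated -1]) (auto simp: hkernel_def)
  then show ?thesis
    unfolding hkernel_sq_sum_def by (rule infsumI)
qed

text \<open>
  Hilbert's inequality with its sharp constant: the bound \<open>3 * hkernel_sq_sum\<close> for the square of the
  norm is exactly \<open>pi\<^sup>2\<close>. The constant matters: with a larger one, the growth bounds below
  would cover only smaller sampling steps \<open>\<gamma>\<close>.
\<close>

lemma norm_hilbert_op_le: "norm (hilbert_op a) \<le> pi * norm a"
proof (rule l2_norm_le)
  fix F :: "int set" assume "finite F"
  then show "(\<Sum>n\<in>F. (cmod (l2_nth (hilbert_op a) n))\<^sup>2) \<le> (pi * norm a)\<^sup>2"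
    using hilbert_seq_sum_le[of F a]
    by (simp add: l2_nth_hilbert_op hilbert_seq_def hkernel_sq_sum_eq power_mult_distrib)
qed auto

section \<open>Growth of the matrix coefficients of exp (z H)\<close>

lemma op_power_Suc: "op_power T (Suc k) a = T (op_power T k a)"
  by (simp add: op_power_def)

lemma op_power_0: "op_power T 0 a = a"
  by (simp add: op_power_def)

lemma norm_hilbert_power_le: "norm (op_power hilbert_op k a) \<le> pi ^ k * norm a"
proof (induction k)
  case (Suc k)
  have "norm (op_power hilbert_op (Suc k) a) \<le> pi * norm (op_power hilbert_op k a)"
    by (simp add: op_power_Suc norm_hilbert_op_le)
  also have "\<dots> \<le> pi * (pi ^ k * norm a)"
    by (intro mult_left_mono Suc.IH) auto
  finally show ?case by simp
qed (simp add: op_power_0)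

lemma hilbert_power_adjoint:
  "l2_cinner (op_power hilbert_op j a) (op_power hilbert_op k b) =
    (-1) ^ k * l2_cinner (op_power hilbert_op (j + k) a) b"
proof (induction k arbitrary: j)
  case (Suc k)
  have "l2_cinner (op_power hilbert_op j a) (op_power hilbert_op (Suc k) b) =
      - l2_cinner (op_power hilbert_op (Suc j) a) (op_power hilbert_op k b)"
    by (simp add: op_power_Suc hilbert_op_skew_adjoint)
  then show ?case using Suc.IH[of "Suc j"] by simp
qed (simp add: op_power_0)

lemma op_exp_sums: "(\<lambda>k. l2_cscale (z ^ k / fact k) (op_power T k a)) sums op_exp z T a"
  using bounded_linear.sums[OF blinfun.bounded_linear_left[of a] summable_sums[OF op_exp_summable[of z T]]]
  by (simp add: op_exp_def op_cscale_apply)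

lemma op_exp_cinner_sums:
  "(\<lambda>k. z ^ k / fact k * l2_cinner (op_power T k a) b) sums l2_cinner (op_exp z T a) b"
  using bounded_linear.sums[OF bounded_linear_l2_cinner_left op_exp_sums[of z T a], of b]
  by (simp add: l2_cinner_cscale_left)

definition hilbert_moment :: "l2 \<Rightarrow> l2 \<Rightarrow> nat \<Rightarrow> complex" where
  "hilbert_moment a b n = l2_cinner (op_power hilbert_op n a) b"

lemma norm_hilbert_moment_le: "cmod (hilbert_moment a b n) \<le> pi ^ n * (norm a * norm b)"
proof -
  have "cmod (hilbert_moment a b n) \<le> norm (op_power hilbert_op n a) * norm b"
    unfolding hilbert_moment_def by (rule l2_cinner_Cauchy_Schwarz)
  also have "\<dots> \<le> pi ^ n * norm a * norm b"
    by (intro mult_right_mono norm_hilbert_power_le) auto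
  finally show ?thesis by (simp add: mult.assoc)
qed

lemma hilbert_moment_op_power: "hilbert_moment (op_power hilbert_op k a) b n = hilbert_moment a b (n + k)"
proof -
  have "op_power hilbert_op n (op_power hilbert_op k a) = op_power hilbert_op (n + k) a"
    by (induction n) (simp_all add: op_power_0 op_power_Suc)
  then show ?thesis by (simp add: hilbert_moment_def)
qed

definition hilbert_exp_coeff :: "l2 \<Rightarrow> l2 \<Rightarrow> complex \<Rightarrow> complex" where
  "hilbert_exp_coeff a b z = l2_cinner (op_exp z hilbert_op a) b"

lemma hilbert_exp_coeff_sums: "(\<lambda>n. hilbert_moment a b n / fact n * z ^ n) sums hilbert_exp_coeff a b z"
  using op_exp_cinner_sums[of z hilbert_op a b]
  by (simp add: hilbert_exp_coeff_def hilbert_moment_def mult.commute)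

lemma has_field_derivative_hilbert_exp_coeff:
  "(hilbert_exp_coeff a b has_field_derivative hilbert_exp_coeff (hilbert_op a) b z) (at z)"
proof -
  have eq: "hilbert_exp_coeff a b = (\<lambda>z. \<Sum>n. hilbert_moment a b n / fact n * z ^ n)" for a b
    using hilbert_exp_coeff_sums[of a b] by (auto simp: sums_iff)
  have "diffs (\<lambda>n. hilbert_moment a b n / fact n) = (\<lambda>n. hilbert_moment (hilbert_op a) b n / fact n)"
    using hilbert_moment_op_power[of 1 a b]
    by (auto simp: diffs_def field_simps op_power_def simp del: of_nat_Suc)
  then show ?thesis
    using termdiffs_strong_converges_everywhere[of "\<lambda>n. hilbert_moment a b n / fact n" z]
      hilbert_exp_coeff_sums[of a b]
    unfolding eq[of a b] eq[of "hilbert_op a" b] by (auto simp: sums_iff)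
qed

text \<open>
  Differentiation in \<open>z\<close> amounts to applying \<open>H\<close> to the first vector, which identifies all Taylor
  coefficients of a matrix coefficient at an arbitrary centre.
\<close>

lemma higher_deriv_hilbert_exp_coeff:
  "(deriv ^^ k) (hilbert_exp_coeff a b) = hilbert_exp_coeff (op_power hilbert_op k a) b"
proof (induction k)
  case (Suc k)
  then show ?case
    using has_field_derivative_hilbert_exp_coeff by (auto simp: op_power_Suc intro!: DERIV_imp_deriv)
qed (simp add: op_power_0)

lemma holomorphic_hilbert_exp_coeff: "hilbert_exp_coeff a b holomorphic_on S"
  by (rule holomorphic_onI)
    (use has_field_derivative_hilbert_exp_coeff field_differentiable_at_within field_differentiable_def in blast)

text \<open>
  This is \<open>exp (w H)* exp (z H) = exp ((z - cnj w) H)\<close> for skew-adjoint \<open>H\<close>. Moving the powers of \<open>H\<close>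
  in the series of \<open>exp (w H) b\<close> onto the other side, with a sign for each factor, turns that series into
  the Taylor expansion about \<open>z\<close> of the entire function \<open>hilbert_exp_coeff a b\<close>, evaluated at \<open>z - cnj w\<close>;
  this takes the place of the addition theorem for operator exponentials.
\<close>

lemma l2_cinner_hilbert_exp_hilbert_exp:
  "l2_cinner (op_exp z hilbert_op a) (op_exp w hilbert_op b) = hilbert_exp_coeff a b (z - cnj w)"
proof -
  have swap: "l2_cinner (op_exp z hilbert_op a) (op_power hilbert_op k b) =
      (-1) ^ k * hilbert_exp_coeff (op_power hilbert_op k a) b z" for k
  proof (rule sums_unique2)
    show "(\<lambda>n. z ^ n / fact n * l2_cinner (op_power hilbert_op n a) (op_power hilbert_op k b)) sums
        l2_cinner (op_exp z hilbert_op a) (op_power hilbert_op k b)"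
      by (rule op_exp_cinner_sums)
    show "(\<lambda>n. z ^ n / fact n * l2_cinner (op_power hilbert_op n a) (op_power hilbert_op k b)) sums
        ((-1) ^ k * hilbert_exp_coeff (op_power hilbert_op k a) b z)"
      using sums_mult[OF hilbert_exp_coeff_sums[of "op_power hilbert_op k a" b z], of "(-1) ^ k"]
      by (simp add: hilbert_power_adjoint hilbert_moment_op_power) (simp add: hilbert_moment_def mult_ac)
  qed
  have "(\<lambda>k. (deriv ^^ k) (hilbert_exp_coeff a b) z / fact k * ((z - cnj w) - z) ^ k) sums
      hilbert_exp_coeff a b (z - cnj w)"
    by (rule holomorphic_power_series[where r = "cmod w + 1"])
      (auto simp: holomorphic_hilbert_exp_coeff dist_norm)
  moreover have "(deriv ^^ k) (hilbert_exp_coeff a b) z / fact k * ((z - cnj w) - z) ^ k =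
      cnj (w ^ k / fact k) * l2_cinner (op_exp z hilbert_op a) (op_power hilbert_op k b)" for k
    by (simp add: swap higher_deriv_hilbert_exp_coeff power_minus[of "cnj w"] )
  moreover have "(\<lambda>k. cnj (w ^ k / fact k) * l2_cinner (op_exp z hilbert_op a) (op_power hilbert_op k b)) sums
      l2_cinner (op_exp z hilbert_op a) (op_exp w hilbert_op b)"
    using bounded_linear.sums[OF bounded_linear_cnj
        op_exp_cinner_sums[of w hilbert_op b "op_exp z hilbert_op a"]]
    by (simp add: cnj_l2_cinner)
  ultimately show ?thesis
    by (metis (no_types, lifting) ext sums_unique2)
qed

lemma norm_hilbert_exp_coeff_le_exp_norm: "cmod (hilbert_exp_coeff a b z) \<le> norm a * norm b * exp (pi * cmod z)"
proof (rule norm_sums_le)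
  show "(\<lambda>n. hilbert_moment a b n / fact n * z ^ n) sums hilbert_exp_coeff a b z"
    by (rule hilbert_exp_coeff_sums)
  show "(\<lambda>n. norm a * norm b * ((pi * cmod z) ^ n /\<^sub>R fact n)) sums (norm a * norm b * exp (pi * cmod z))"
    by (intro sums_mult exp_converges)
  show "cmod (hilbert_moment a b n / fact n * z ^ n) \<le> norm a * norm b * ((pi * cmod z) ^ n /\<^sub>R fact n)" for n
    using mult_right_mono[OF norm_hilbert_moment_le[of a b n], of "cmod z ^ n / fact n"]
    by (simp add: norm_mult norm_divide norm_power power_mult_distrib field_simps)
qed

text \<open>
  The square of the norm is the matrix coefficient at \<open>z - cnj z = 2 * \<i> * Im z\<close>, so the bound
  \<open>exp (pi * cmod z)\<close> from the power series already gives an estimate in which the real part of \<open>z\<close>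
  has disappeared.
\<close>

lemma norm_hilbert_exp_le: "norm (op_exp z hilbert_op a) \<le> exp (pi * \<bar>Im z\<bar>) * norm a"
proof (rule power2_le_imp_le)
  have "z - cnj z = \<i> * of_real (2 * Im z)"
    by (simp add: complex_eq_iff)
  then have "cmod (z - cnj z) = 2 * \<bar>Im z\<bar>"
    by (simp add: norm_mult)
  moreover have "complex_of_real ((norm (op_exp z hilbert_op a))\<^sup>2) = hilbert_exp_coeff a a (z - cnj z)"
    by (metis l2_cinner_self l2_cinner_hilbert_exp_hilbert_exp)
  then have "(norm (op_exp z hilbert_op a))\<^sup>2 = cmod (hilbert_exp_coeff a a (z - cnj z))"
    by (metis abs_of_nonneg norm_of_real zero_le_power2)
  ultimately have "(norm (op_exp z hilbert_op a))\<^sup>2 \<le> norm a * norm a * exp (pi * (2 * \<bar>Im z\<bar>))"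
    using norm_hilbert_exp_coeff_le_exp_norm[of a a "z - cnj z"] by simp
  also have "\<dots> = (exp (pi * \<bar>Im z\<bar>) * norm a)\<^sup>2"
    by (simp add: power2_eq_square mult_ac flip: exp_add)
  finally show "(norm (op_exp z hilbert_op a))\<^sup>2 \<le> (exp (pi * \<bar>Im z\<bar>) * norm a)\<^sup>2" .
qed auto

lemma norm_hilbert_exp_coeff_le: "cmod (hilbert_exp_coeff a b z) \<le> norm a * norm b * exp (pi * \<bar>Im z\<bar>)"
proof -
  have "cmod (hilbert_exp_coeff a b z) \<le> norm (op_exp z hilbert_op a) * norm b"
    unfolding hilbert_exp_coeff_def by (rule l2_cinner_Cauchy_Schwarz)
  also have "\<dots> \<le> exp (pi * \<bar>Im z\<bar>) * norm a * norm b"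
    by (intro mult_right_mono norm_hilbert_exp_le) auto
  finally show ?thesis by (simp add: mult_ac)
qed

section \<open>Estimates for the sine and for integrals over vertical segments\<close>

lemma exp_neg_abs_le: "exp (- \<bar>u\<bar>) \<le> 2 / (1 + u\<^sup>2)" for u :: real
proof -
  have "1 + u\<^sup>2 \<le> 2 * exp \<bar>u\<bar>"
    using exp_lower_Taylor_quadratic[of "\<bar>u\<bar>"] by simp
  moreover have "1 + u\<^sup>2 > 0"
    by (simp add: add_pos_nonneg)
  ultimately show ?thesis
    by (simp add: exp_minus field_simps)
qed

text \<open>
  The bound must not depend on the length \<open>2 * R\<close> of the segment, because \<open>R\<close> tends to infinity before
  the vertical sides move away. The exponential is replaced by \<open>2 / (1 + (c * y)\<^sup>2)\<close>, whose
  antiderivative is a multiple of an arctangent, hence bounded.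
\<close>

lemma norm_contour_integral_vertical_le:
  fixes f :: "complex \<Rightarrow> complex" and c x B R :: real
  assumes int: "f contour_integrable_on (linepath p q)"
    and pq: "Re p = x" "Re q = x" "Im p = - R" "Im q = R" and "R > 0" "c > 0" "B \<ge> 0"
    and bound: "\<And>y. cmod (f (Complex x y)) \<le> B * exp (- c * \<bar>y\<bar>)"
  shows "cmod (contour_integral (linepath p q) f) \<le> 2 * pi * B / c"
proof -
  let ?I = "contour_integral (linepath p q) f"
  have "(f has_contour_integral ?I) (linepath p q)"
    using int by (rule has_contour_integral_integral)
  then have I: "((\<lambda>y. f (Complex x y)) has_integral (- \<i> * ?I)) {-R..R}"
    using has_contour_integral_linepath_same_Re_iff[of p x q "-R" R f ?I] pq \<open>R > 0\<close> by simp
  have J: "((\<lambda>y. 2 * B / (1 + (c * y)\<^sup>2)) has_integral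
      (2 * B / c * arctan (c * R) - 2 * B / c * arctan (c * (- R)))) {-R..R}"
  proof (rule fundamental_theorem_of_calculus)
    show "((\<lambda>y. 2 * B / c * arctan (c * y)) has_vector_derivative 2 * B / (1 + (c * y)\<^sup>2))
        (at y within {-R..R})" for y
      unfolding has_real_derivative_iff_has_vector_derivative[symmetric]
      using \<open>c > 0\<close> by (auto intro!: derivative_eq_intros simp: divide_inverse)
  qed (use \<open>R > 0\<close> in auto)
  have "cmod (f (Complex x y)) \<le> 2 * B / (1 + (c * y)\<^sup>2)" for y
  proof -
    have "B * exp (- c * \<bar>y\<bar>) \<le> B * (2 / (1 + (c * y)\<^sup>2))"
      using exp_neg_abs_le[of "c * y"] \<open>c > 0\<close> \<open>B \<ge> 0\<close>
      by (intro mult_left_mono) (auto simp: abs_mult)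
    with bound[of y] show ?thesis by (simp add: mult.commute)
  qed
  then have "norm (integral {-R..R} (\<lambda>y. f (Complex x y))) \<le> integral {-R..R} (\<lambda>y. 2 * B / (1 + (c * y)\<^sup>2))"
    using I J by (intro integral_norm_bound_integral) auto
  then have "cmod (- \<i> * ?I) \<le> 2 * B / c * arctan (c * R) - 2 * B / c * arctan (c * (- R))"
    using I J by (simp add: integral_unique)
  then have "cmod ?I \<le> 4 * B / c * arctan (c * R)"
    by (simp add: norm_mult arctan_minus)
  also have "\<dots> \<le> 4 * B / c * (pi / 2)"
    using arctan_ubound[of "c * R"] \<open>c > 0\<close> \<open>B \<ge> 0\<close> by (intro mult_left_mono) auto
  finally show ?thesis by (simp add: mult_ac)
qed

text \<open>
  Halfway between two consecutive zeros the modulus of \<open>sin (pi * w)\<close> is \<open>cosh (pi * Im w)\<close>, so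
  exponential growth holds with a uniform constant down to the real axis.
\<close>

lemma norm_sin_pi_half_integer_ge:
  fixes n :: int
  assumes "Re w = of_int n + 1/2"
  shows "exp (pi * \<bar>Im w\<bar>) / 2 \<le> cmod (sin (of_real pi * w))"
proof -
  have "2 * (pi * Re w) = pi * of_int (2 * n + 1)"
    using assms by (simp add: algebra_simps)
  then have "cos (2 * (pi * Re w)) = cos (pi * of_int (2 * n + 1))"
    by (rule arg_cong)
  also have "\<dots> = -1"
    by (subst cos_npi_int) auto
  finally have cos: "cos (2 * (pi * Re w)) = -1" .
  have "(exp (pi * \<bar>Im w\<bar>) / 2)\<^sup>2 = exp (2 * (pi * \<bar>Im w\<bar>)) / 4"
    by (simp add: power2_eq_square flip: exp_add)
  also have "\<dots> \<le> (exp (2 * (pi * Im w)) + inverse (exp (2 * (pi * Im w)))) / 4"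
    by (cases "Im w \<ge> 0") (simp_all flip: exp_minus)
  also have "\<dots> \<le> (cmod (sin (of_real pi * w)))\<^sup>2"
    unfolding norm_sin_squared using cos by simp
  finally show ?thesis
    by (rule power2_le_imp_le) auto
qed

lemma norm_sin_pi_ge:
  assumes "\<bar>Im w\<bar> \<ge> 1"
  shows "exp (pi * \<bar>Im w\<bar>) / 4 \<le> cmod (sin (of_real pi * w))"
proof -
  have "pi * \<bar>Im w\<bar> \<ge> 3 * 1"
    using assms pi_gt3 by (intro mult_mono) auto
  then have "4 \<le> exp (pi * \<bar>Im w\<bar>)"
    using exp_ge_add_one_self[of "pi * \<bar>Im w\<bar>"] by linarith
  then have "4 * 4 \<le> exp (pi * \<bar>Im w\<bar>) * exp (pi * \<bar>Im w\<bar>)"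
    by (intro mult_mono) auto
  then have big: "8 \<le> exp (2 * (pi * \<bar>Im w\<bar>))"
    by (simp flip: exp_add)
  have "(exp (pi * \<bar>Im w\<bar>) / 4)\<^sup>2 = exp (2 * (pi * \<bar>Im w\<bar>)) / 16"
    by (simp add: power2_eq_square flip: exp_add)
  also have "\<dots> \<le> (exp (2 * (pi * \<bar>Im w\<bar>)) - 2) / 4"
    using big by simp
  also have "\<dots> \<le> (exp (2 * (pi * Im w)) + inverse (exp (2 * (pi * Im w))) - 2) / 4"
    by (cases "Im w \<ge> 0") (simp_all flip: exp_minus)
  also have "\<dots> \<le> (exp (2 * (pi * Im w)) + inverse (exp (2 * (pi * Im w))) - 2 * cos (2 * (pi * Re w))) / 4"
    by simp
  also have "\<dots> = (cmod (sin (of_real pi * w)))\<^sup>2"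
    unfolding norm_sin_squared by simp
  finally show ?thesis
    by (rule power2_le_imp_le) auto
qed

lemma sin_pi_eq_0_iff: "sin (of_real pi * w) = 0 \<longleftrightarrow> w \<in> \<int>" for w :: complex
  unfolding sin_eq_0 by (auto simp: Ints_def mult.commute)

lemma cos_pi_of_int: "cos (of_real pi * of_int k :: complex) = (-1) powi k"
proof -
  have "cos (of_real pi * of_int k :: complex) = of_real (cos (pi * of_int k))"
    using cos_of_real[of "pi * of_int k", where 'a = complex] by simp
  also have "cos (pi * of_int k) = (-1) powi k"
    by (simp add: cos_npi_int power_int_minus_left)
  finally show ?thesis by simp
qed

lemma DERIV_sin_pi_of_int:
  "((\<lambda>w. sin (of_real pi * w)) has_field_derivative (of_real pi * (-1) powi k)) (at (of_int k :: complex))"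
  by (auto intro!: derivative_eq_intros simp: cos_pi_of_int)

lemma csinc_of_int: "csinc (of_int j) = (if j = 0 then 1 else 0)"
  using sin_pi_eq_0_iff[of "of_int j"] by (simp add: csinc_def)

lemma csinc_diff_of_int:
  assumes "z \<notin> \<int>"
  shows "csinc (z - of_int k) = sin (of_real pi * z) * (-1) powi k / (of_real pi * (z - of_int k))"
proof -
  have s: "sin (of_real pi * of_int k :: complex) = 0"
    by (simp add: sin_pi_eq_0_iff)
  have "z - of_int k \<noteq> 0"
    using assms by auto
  then show ?thesis
    by (simp add: csinc_def right_diff_distrib sin_diff cos_pi_of_int s)
qed

section \<open>The cardinal series of a function of exponential type below pi\<close>

lemma residue_cardinal_kernel_at_int:
  fixes F :: "complex \<Rightarrow> complex" and k :: int
  assumes F: "F holomorphic_on UNIV" and z: "z \<notin> \<int>"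
  shows "residue (\<lambda>w. F w / ((w - z) * sin (of_real pi * w))) (of_int k) =
    F (of_int k) / ((of_int k - z) * (of_real pi * (-1) powi k))"
proof (rule residue_simple')
  let ?S = "- insert z (\<int> - {of_int k})"
  have "closed (\<int> - {of_int k} :: complex set)"
    by (rule closed_subset_Ints) auto
  then show "open ?S" by (auto intro: closed_insert)
  show "of_int k \<in> ?S" using z by auto
  show "(\<lambda>w. F w / ((w - z) * sin (of_real pi * w))) holomorphic_on ?S - {of_int k}"
    by (intro holomorphic_intros holomorphic_on_subset[OF F]) (auto simp: sin_pi_eq_0_iff)
  have sin0: "sin (of_real pi * of_int k :: complex) = 0"
    by (simp add: sin_pi_eq_0_iff)
  have "((\<lambda>w. sin (of_real pi * w) / (w - of_int k)) \<longlongrightarrow> of_real pi * (-1) powi k) (at (of_int k :: complex))"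
    using DERIV_sin_pi_of_int[of k] unfolding has_field_derivative_iff sin0 by simp
  moreover have "(F \<longlongrightarrow> F (of_int k)) (at (of_int k))"
    using holomorphic_on_imp_continuous_on[OF F]
    by (simp add: continuous_on_eq_continuous_at isCont_def)
  moreover have "of_int k - z \<noteq> 0"
    using z by auto
  ultimately have "((\<lambda>w. F w / ((w - z) * (sin (of_real pi * w) / (w - of_int k)))) \<longlongrightarrow>
      F (of_int k) / ((of_int k - z) * (of_real pi * (-1) powi k))) (at (of_int k))"
    by (intro tendsto_intros) auto
  then show "((\<lambda>w. F w / ((w - z) * sin (of_real pi * w)) * (w - of_int k)) \<longlongrightarrow>
      F (of_int k) / ((of_int k - z) * (of_real pi * (-1) powi k))) (at (of_int k))"
    by (simp add: mult.assoc)
qed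

lemma residue_cardinal_kernel_at_point:
  fixes F :: "complex \<Rightarrow> complex"
  assumes F: "F holomorphic_on UNIV" and z: "z \<notin> \<int>"
  shows "residue (\<lambda>w. F w / ((w - z) * sin (of_real pi * w))) z = F z / sin (of_real pi * z)"
proof -
  have "residue (\<lambda>w. (F w / sin (of_real pi * w)) / (w - z)) z = F z / sin (of_real pi * z)"
  proof (rule residue_simple)
    show "open (- \<int> :: complex set)"
      by (auto intro: closed_subset_Ints)
    show "(\<lambda>w. F w / sin (of_real pi * w)) holomorphic_on - \<int>"
      by (intro holomorphic_intros holomorphic_on_subset[OF F]) (auto simp: sin_pi_eq_0_iff)
  qed (use z in auto)
  then show ?thesis by (simp add: mult.commute)
qed

text \<open>
  Up to the factor \<open>sin (pi * z)\<close>, the terms of the cardinal series and the value \<open>F z\<close> are the residues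
  of \<open>F w / ((w - z) * sin (pi * w))\<close>. The remainder is therefore a contour integral over the rectangle
  with vertical sides through \<open>- M - 1/2\<close> and \<open>N + 1/2\<close>. Since \<open>sin (pi * w)\<close> dominates \<open>F w\<close> by the
  factor \<open>exp ((pi - s) * \<bar>Im w\<bar>)\<close> on the sides of the rectangle, the horizontal sides vanish in the
  limit, and each vertical side contributes a constant divided by a lower bound for its distance to
  \<open>z\<close>. The horizontal sides grow with \<open>M + N\<close>; letting the height tend to infinity with \<open>M\<close> and \<open>N\<close>
  fixed removes them without any relation between \<open>M\<close> and \<open>N\<close>.
\<close>

lemma cardinal_series_remainder_le:
  fixes F :: "complex \<Rightarrow> complex" and A s :: real and z :: complex and M N :: nat
  assumes F: "F holomorphic_on UNIV"
    and bound: "\<And>w. cmod (F w) \<le> A * exp (s * \<bar>Im w\<bar>)"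
    and s: "s < pi" and z: "z \<notin> \<int>"
    and M: "cmod z < real M + 1/2" and N: "cmod z < real N + 1/2"
  shows "cmod (F z - (\<Sum>k\<in>{- int M..int N}. F (of_int k) * csinc (z - of_int k)))
    \<le> cmod (sin (of_real pi * z)) * (2 * A / (pi - s))
        * (1 / (real M + 1/2 - cmod z) + 1 / (real N + 1/2 - cmod z))"
proof -
  define c where "c = pi - s"
  define G where "G = (\<lambda>w. F w / ((w - z) * sin (of_real pi * w)))"
  define E where "E = F z - (\<Sum>k\<in>{- int M..int N}. F (of_int k) * csinc (z - of_int k))"
  define d where "d = real M + 1/2 - cmod z"
  define d' where "d' = real N + 1/2 - cmod z"
  have c: "c > 0" and d: "d > 0" and d': "d' > 0"
    using s M N by (auto simp: c_def d_def d'_def)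
  have A: "A \<ge> 0"
    using order_trans[OF norm_ge_zero bound[of 0]] by simp
  have sin_z: "sin (of_real pi * z) \<noteq> 0"
    using z by (simp add: sin_pi_eq_0_iff)
  have norm_G: "cmod (G w) \<le> A * K * exp (- c * \<bar>Im w\<bar>) / e"
    if "exp (pi * \<bar>Im w\<bar>) / K \<le> cmod (sin (of_real pi * w))" "e \<le> cmod (w - z)" "e > 0" "K > 0"
    for w e K
  proof -
    have "cmod (G w) \<le> A * exp (s * \<bar>Im w\<bar>) / (e * (exp (pi * \<bar>Im w\<bar>) / K))"
      unfolding G_def norm_divide norm_mult
      using that A by (intro frac_le bound mult_mono) auto
    also have "\<dots> = A * K * exp (s * \<bar>Im w\<bar> - pi * \<bar>Im w\<bar>) / e"
      by (simp add: exp_diff mult_ac)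
    also have "s * \<bar>Im w\<bar> - pi * \<bar>Im w\<bar> = - c * \<bar>Im w\<bar>"
      by (simp add: c_def algebra_simps)
    finally show ?thesis .
  qed
  \<comment> \<open>The contributions of the two vertical sides and, at height \<open>R\<close>, of the two horizontal ones.\<close>
  define V where "V = 4 * pi * A / c * (1 / d + 1 / d')"
  define h where "h = (\<lambda>R. 8 * A * (real M + real N + 1) * exp (- c * R))"
  have main: "2 * pi * cmod E \<le> cmod (sin (of_real pi * z)) * (V + h R)" if R: "R \<ge> cmod z + 1" for R
  proof -
    define p where "p = Complex (- real M - 1/2) (- R)"
    define q where "q = Complex (real N + 1/2) R"
    define p' where "p' = Complex (real N + 1/2) (- R)"
    define q' where "q' = Complex (- real M - 1/2) R"
    \<comment> \<open>A strip that contains the rectangle and no further pole of \<open>G\<close>.\<close>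
    define S where "S = {w. - real M - 1 < Re w} \<inter> {w. Re w < real N + 1}"
    define P :: "complex set" where "P = of_int ` {- int M..int N}"
    have R1: "R \<ge> 1" using R norm_ge_zero[of z] by linarith
    have "open S" "convex S"
      unfolding S_def
      by (auto intro!: open_Int open_halfspace_Re_gt open_halfspace_Re_lt convex_Int
          convex_halfspace_Re_gt convex_halfspace_Re_lt)
    have ints: "w \<in> P" if "w \<in> \<int>" "w \<in> S" for w
      using that by (auto simp: P_def S_def elim!: Ints_cases)
    have G: "G holomorphic_on S - insert z P"
      unfolding G_def using ints
      by (intro holomorphic_intros holomorphic_on_subset[OF F]) (auto simp: sin_pi_eq_0_iff)
    have inbox: "w \<in> box p q" if "w \<in> insert z P" for w
      using that M N R R1 abs_Re_le_cmod[of z] abs_Im_le_cmod[of z]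
      by (auto simp: in_box_complex_iff p_def q_def P_def)
    have cboxS: "cbox p q \<subseteq> S"
      by (auto simp: in_cbox_complex_iff p_def q_def S_def)
    have le: "Re p \<le> Re q" "Im p \<le> Im q"
      using R1 by (auto simp: p_def q_def)
    have img: "path_image (rectpath p q) \<subseteq> S - insert z P"
      using path_image_rectpath_cbox_minus_box[OF le] inbox cboxS by auto
    have "contour_integral (rectpath p q) G =
        2 * pi * \<i> * (\<Sum>w\<in>insert z P. winding_number (rectpath p q) w * residue G w)"
    proof (rule Residue_theorem[of S])
      show "\<forall>w. w \<notin> S \<longrightarrow> winding_number (rectpath p q) w = 0"
        using winding_number_rectpath_outside[OF le] cboxS by blast
    qed (use \<open>open S\<close> \<open>convex S\<close> G img in \<open>auto simp: P_def convex_connected\<close>)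
    also have "(\<Sum>w\<in>insert z P. winding_number (rectpath p q) w * residue G w) = (\<Sum>w\<in>insert z P. residue G w)"
      by (intro sum.cong refl) (simp add: winding_number_rectpath inbox)
    also have "\<dots> = residue G z + (\<Sum>w\<in>P. residue G w)"
      using z by (subst sum.insert) (auto simp: P_def)
    also have "(\<Sum>w\<in>P. residue G w) = (\<Sum>k\<in>{- int M..int N}. residue G (of_int k))"
      unfolding P_def by (subst sum.reindex) (auto simp: inj_on_def)
    also have "residue G z = F z / sin (of_real pi * z)"
      unfolding G_def by (rule residue_cardinal_kernel_at_point[OF F z])
    also have "(\<Sum>k\<in>{- int M..int N}. residue G (of_int k)) =
        (\<Sum>k\<in>{- int M..int N}. - (F (of_int k) * csinc (z - of_int k)) / sin (of_real pi * z))"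
    proof (intro sum.cong refl)
      fix k
      have alg: "f / (- u * (of_real pi * t)) = - (f * (S * t / (of_real pi * u))) / S"
        if "u \<noteq> 0" "S \<noteq> 0" "t = 1 \<or> t = -1" for f u t S :: complex
        using that by (auto simp: divide_simps)
      have "(-1 :: complex) powi k = 1 \<or> (-1 :: complex) powi k = -1"
        by (simp add: power_int_minus_left)
      moreover have "z - of_int k \<noteq> 0"
        using z by auto
      ultimately show "residue G (of_int k) = - (F (of_int k) * csinc (z - of_int k)) / sin (of_real pi * z)"
        unfolding G_def residue_cardinal_kernel_at_int[OF F z] csinc_diff_of_int[OF z]
        using alg[OF _ sin_z, of "z - of_int k" "(-1) powi k" "F (of_int k)"] by simp
    qed
    also have "F z / sin (of_real pi * z) + \<dots> = E / sin (of_real pi * z)"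
      by (simp add: E_def diff_divide_distrib sum_divide_distrib sum_negf)
    finally have "contour_integral (rectpath p q) G = 2 * pi * \<i> * (E / sin (of_real pi * z))" .
    then have norm_E: "2 * pi * cmod E = cmod (sin (of_real pi * z)) * cmod (contour_integral (rectpath p q) G)"
      using sin_z by (simp add: norm_mult norm_divide)

    have rect: "rectpath p q = linepath p p' +++ linepath p' q +++ linepath q q' +++ linepath q' p"
      by (simp add: rectpath_def Let_def p_def q_def p'_def q'_def)
    have cont: "continuous_on (closed_segment u v) G"
      if "closed_segment u v \<subseteq> path_image (rectpath p q)" for u v
      using that img by (intro continuous_on_subset[OF holomorphic_on_imp_continuous_on[OF G]]) auto
    have conts: "continuous_on (closed_segment p p') G" "continuous_on (closed_segment p' q) G"
      "continuous_on (closed_segment q q') G" "continuous_on (closed_segment q' p) G"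
      by (rule cont; auto simp: rect path_image_join)+
    note integrable = conts[THEN contour_integrable_continuous_linepath]
    have "contour_integral (rectpath p q) G = contour_integral (linepath p p') G +
        (contour_integral (linepath p' q) G + (contour_integral (linepath q q') G
          + contour_integral (linepath q' p) G))"
      unfolding rect using integrable by (simp add: valid_path_join)
    moreover have "cmod (i1 + (i2 + (i3 + i4))) \<le> cmod i1 + (cmod i2 + (cmod i3 + cmod i4))"
      for i1 i2 i3 i4 :: complex
      by (intro norm_triangle_mono order_refl)
    ultimately have triangle: "cmod (contour_integral (rectpath p q) G) \<le> cmod (contour_integral (linepath p p') G) +
        (cmod (contour_integral (linepath p' q) G) + (cmod (contour_integral (linepath q q') G)
          + cmod (contour_integral (linepath q' p) G)))"
      by simp
    have horizontal: "cmod (contour_integral (linepath u v) G) \<le> h R / 2"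
      if "G contour_integrable_on linepath u v" "\<And>w. w \<in> closed_segment u v \<Longrightarrow> \<bar>Im w\<bar> = R"
        "cmod (v - u) = real M + real N + 1" for u v
    proof -
      have "cmod (contour_integral (linepath u v) G) \<le> A * 4 * exp (- c * R) / 1 * cmod (v - u)"
      proof (rule contour_integral_bound_linepath)
        fix w assume "w \<in> closed_segment u v"
        then have w: "\<bar>Im w\<bar> = R" by (rule that)
        have "cmod w \<ge> R" using abs_Im_le_cmod[of w] w by simp
        then have "1 \<le> cmod (w - z)" using norm_triangle_ineq2[of w z] R by linarith
        then show "cmod (G w) \<le> A * 4 * exp (- c * R) / 1"
          using norm_G[of w 4 1] norm_sin_pi_ge[of w] w R1 by simp
      qed (use that A in auto)
      also have "\<dots> = h R / 2"
        by (simp add: that h_def field_simps)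
      finally show ?thesis .
    qed
    have len: "cmod (p' - p) = real M + real N + 1" "cmod (q' - q) = real M + real N + 1"
      by (simp_all add: p_def p'_def q_def q'_def cmod_eq_Re)
    have bottom: "cmod (contour_integral (linepath p p') G) \<le> h R / 2"
      by (rule horizontal[OF integrable(1) _ len(1)])
        (use R1 in \<open>auto simp: closed_segment_same_Im p_def p'_def\<close>)
    have top: "cmod (contour_integral (linepath q q') G) \<le> h R / 2"
      by (rule horizontal[OF integrable(3) _ len(2)])
        (use R1 in \<open>auto simp: closed_segment_same_Im q_def q'_def\<close>)
    have vertical: "cmod (contour_integral (linepath u v) G) \<le> 4 * pi * A / c * (1 / e)"
      if "G contour_integrable_on linepath u v" "Re u = of_int n + 1/2" "Re v = of_int n + 1/2"
        "Im u = - R" "Im v = R" "e > 0" "e \<le> \<bar>of_int n + 1/2\<bar> - cmod z" for u v e and n :: int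
    proof -
      have "cmod (contour_integral (linepath u v) G) \<le> 2 * pi * (A * 2 / e) / c"
      proof (rule norm_contour_integral_vertical_le[OF that(1-5)])
        fix y
        let ?w = "Complex (of_int n + 1/2) y"
        have "e \<le> cmod (?w - z)"
          using abs_Re_le_cmod[of ?w] norm_triangle_ineq2[of ?w z] that by simp
        then show "cmod (G ?w) \<le> A * 2 / e * exp (- c * \<bar>y\<bar>)"
          using norm_G[of ?w 2 e] norm_sin_pi_half_integer_ge[of ?w n] that by simp
      qed (use R1 c A that in auto)
      then show ?thesis by (simp add: field_simps)
    qed
    have right: "cmod (contour_integral (linepath p' q) G) \<le> 4 * pi * A / c * (1 / d')"
      using integrable(2) d' by (intro vertical[of _ _ "int N"]) (auto simp: p'_def q_def d'_def)
    have left: "cmod (contour_integral (linepath q' p) G) \<le> 4 * pi * A / c * (1 / d)"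
    proof -
      have "continuous_on (closed_segment p q') G"
        using conts(4) by (subst closed_segment_commute)
      then have pq': "G contour_integrable_on linepath p q'"
        by (rule contour_integrable_continuous_linepath)
      have "contour_integral (linepath q' p) G = - contour_integral (linepath p q') G"
        using conts(4) by (rule contour_integral_reverse_linepath)
      moreover have "cmod (contour_integral (linepath p q') G) \<le> 4 * pi * A / c * (1 / d)"
        using pq' d by (intro vertical[of _ _ "- int M - 1"]) (auto simp: p_def q'_def d_def)
      ultimately show ?thesis by simp
    qed
    have "cmod (contour_integral (rectpath p q) G) \<le> V + h R"
      using triangle bottom top right left unfolding V_def distrib_left by linarith
    then show ?thesis
      unfolding norm_E by (intro mult_left_mono) auto
  qed
  have "((\<lambda>R. cmod (sin (of_real pi * z)) * (V + h R)) \<longlongrightarrow> cmod (sin (of_real pi * z)) * (V + 0)) at_top"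
  proof (intro tendsto_intros)
    show "(h \<longlongrightarrow> 0) at_top"
      unfolding h_def using c by real_asymp
  qed
  then have "2 * pi * cmod E \<le> cmod (sin (of_real pi * z)) * (V + 0)"
    using eventually_mono[OF eventually_ge_at_top[of "cmod z + 1"] main]
    by (rule tendsto_lowerbound) auto
  then have "2 * pi * cmod E \<le> 2 * pi * (cmod (sin (of_real pi * z)) * (2 * A / c) * (1 / d + 1 / d'))"
    unfolding V_def by (simp only: add_0_right) (simp add: mult_ac del: distrib_left_numeral)
  then show ?thesis
    unfolding E_def c_def d_def d'_def by (rule mult_left_le_imp_le) simp
qed

text \<open>
  The remainder estimate is uniform on discs, once \<open>sin (pi * z)\<close> is bounded there. At an integer
  \<open>z\<close> two poles of the contour integral would coincide, but there the series has at most one nonzero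
  term, namely \<open>F z\<close>.
\<close>

theorem cardinal_series_uniform_limit:
  fixes F :: "complex \<Rightarrow> complex" and A s D :: real
  assumes F: "F holomorphic_on UNIV"
    and bound: "\<And>w. cmod (F w) \<le> A * exp (s * \<bar>Im w\<bar>)" and s: "s < pi"
  shows "uniform_limit (cball 0 D)
    (\<lambda>(M, N) z. \<Sum>k\<in>{- int M..int N}. F (of_int k) * csinc (z - of_int k)) F
    (sequentially \<times>\<^sub>F sequentially)"
proof (rule uniform_limitI)
  fix e :: real assume "e > 0"
  define C where "C = exp (pi * \<bar>D\<bar>) * (2 * A / (pi - s))"
  have A: "A \<ge> 0"
    using order_trans[OF norm_ge_zero bound[of 0]] by simp
  have C: "C \<ge> 0"
    using A s by (simp add: C_def)
  obtain N0 :: nat where N0: "\<bar>D\<bar> + 2 * C / e < real N0"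
    using reals_Archimedean2 by blast
  have "dist (\<Sum>k\<in>{- int M..int N}. F (of_int k) * csinc (z - of_int k)) (F z) < e"
    if "M \<ge> N0" "N \<ge> N0" "z \<in> cball 0 D" for M N z
  proof (cases "z \<in> \<int>")
    case True
    then obtain j where j: "z = of_int j" by (auto elim: Ints_cases)
    have "0 \<le> 2 * C / e" using C \<open>e > 0\<close> by simp
    then have "\<bar>real_of_int j\<bar> \<le> real N0"
      using N0 that j by simp
    then have "j \<in> {- int M..int N}" using that by auto
    moreover have "F (of_int k) * csinc (z - of_int k) = (if k = j then F z else 0)" for k
      using csinc_of_int[of "j - k"] by (auto simp: j)
    ultimately show ?thesis using \<open>e > 0\<close> by simp
  next
    case False
    have z: "cmod z \<le> \<bar>D\<bar>" using that by simp
    have recip: "1 / (real L + 1/2 - cmod z) \<le> 1 / (real N0 + 1/2 - \<bar>D\<bar>)" 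
      and large: "cmod z < real L + 1/2" if "L \<ge> N0" for L
    proof -
      have "0 \<le> 2 * C / e" using C \<open>e > 0\<close> by simp
      then show "cmod z < real L + 1/2" "1 / (real L + 1/2 - cmod z) \<le> 1 / (real N0 + 1/2 - \<bar>D\<bar>)"
        using N0 z that by (auto intro!: frac_le)
    qed
    have "cmod (sin (of_real pi * z)) \<le> exp \<bar>Im (of_real pi * z)\<bar>"
      using cmod_sin_le_exp[of 1 "of_real pi * z"] by simp
    also have "\<dots> \<le> exp (pi * \<bar>D\<bar>)"
      using z abs_Im_le_cmod[of z] by (simp add: abs_mult)
    finally have sin_le: "cmod (sin (of_real pi * z)) \<le> exp (pi * \<bar>D\<bar>)" .
    have "cmod (F z - (\<Sum>k\<in>{- int M..int N}. F (of_int k) * csinc (z - of_int k)))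
        \<le> cmod (sin (of_real pi * z)) * (2 * A / (pi - s))
          * (1 / (real M + 1/2 - cmod z) + 1 / (real N + 1/2 - cmod z))"
      using that by (intro cardinal_series_remainder_le F bound s False large)
    also have "\<dots> \<le> C * (1 / (real N0 + 1/2 - \<bar>D\<bar>) + 1 / (real N0 + 1/2 - \<bar>D\<bar>))"
      unfolding C_def using that A s large[of M] large[of N]
      by (intro mult_mono add_mono recip sin_le) auto
    also have "\<dots> < e"
    proof -
      have "0 \<le> 2 * C / e" "2 * C / e < real N0 + 1/2 - \<bar>D\<bar>"
        using C \<open>e > 0\<close> N0 by auto
      moreover from this have "0 < real N0 + 1/2 - \<bar>D\<bar>"
        by (rule le_less_trans)
      ultimately show ?thesis
        using \<open>e > 0\<close> by (simp add: pos_divide_less_eq mult.commute[of e])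
    qed
    finally show ?thesis by (simp add: dist_norm norm_minus_commute)
  qed
  then show "\<forall>\<^sub>F x in sequentially \<times>\<^sub>F sequentially. \<forall>z\<in>cball 0 D.
      dist ((case x of (M, N) \<Rightarrow> \<lambda>z. \<Sum>k\<in>{- int M..int N}. F (of_int k) * csinc (z - of_int k)) z) (F z) < e"
    unfolding eventually_prod_sequentially by (auto intro!: exI[of _ N0])
qed

section \<open>The sampling theorem for exp (z H)\<close>

theorem theorem3p2:
  fixes a a' :: l2 and \<gamma> :: real
  assumes "0 < \<gamma>" and "\<gamma> < 1"
  shows "(\<forall>z :: complex.
            ((\<lambda>(M, N). \<Sum>k\<in>{- int M..int N}.
                l2_cinner (op_exp (of_real (\<gamma> * of_int k)) hilbert_op a) a'
                  * csinc (z / of_real \<gamma> - of_int k))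
              \<longlongrightarrow> l2_cinner (op_exp z hilbert_op a) a') (sequentially \<times>\<^sub>F sequentially))
       \<and> (\<forall>K :: real set. compact K \<longrightarrow>
            uniform_limit K
              (\<lambda>(M, N) t. \<Sum>k\<in>{- int M..int N}.
                l2_cinner (op_exp (of_real (\<gamma> * of_int k)) hilbert_op a) a'
                  * csinc (of_real t / of_real \<gamma> - of_int k))
              (\<lambda>t. l2_cinner (op_exp (of_real t) hilbert_op a) a')
              (sequentially \<times>\<^sub>F sequentially))"
proof -
  define F where "F = (\<lambda>w. hilbert_exp_coeff a a' (of_real \<gamma> * w))"
  define P where "P = (\<lambda>(M, N) z. \<Sum>k\<in>{- int M..int N}. F (of_int k) * csinc (z - of_int k))"
  have "F holomorphic_on UNIV"
    using holomorphic_on_compose[of "\<lambda>w. of_real \<gamma> * w" UNIV "hilbert_exp_coeff a a'"]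
    by (auto simp: F_def o_def intro: holomorphic_intros holomorphic_hilbert_exp_coeff)
  moreover have "cmod (F w) \<le> norm a * norm a' * exp (pi * \<gamma> * \<bar>Im w\<bar>)" for w
    using norm_hilbert_exp_coeff_le[of a a' "of_real \<gamma> * w"] assms by (simp add: F_def abs_mult mult.assoc)
  moreover have "pi * \<gamma> < pi"
    using assms by simp
  ultimately have unif: "uniform_limit (cball 0 D) P F (sequentially \<times>\<^sub>F sequentially)" for D
    unfolding P_def by (rule cardinal_series_uniform_limit)
  have F_eq: "F (z / of_real \<gamma>) = l2_cinner (op_exp z hilbert_op a) a'" for z
    using assms by (simp add: F_def hilbert_exp_coeff_def)
  have P_eq: "P x (z / of_real \<gamma>) = (case x of (M, N) \<Rightarrow> \<Sum>k\<in>{- int M..int N}.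
      l2_cinner (op_exp (of_real (\<gamma> * of_int k)) hilbert_op a) a' * csinc (z / of_real \<gamma> - of_int k))"
    for x z by (simp add: P_def F_def hilbert_exp_coeff_def split: prod.split)
  show ?thesis
  proof (intro conjI allI impI)
    fix z :: complex
    have "((\<lambda>x. P x (z / of_real \<gamma>)) \<longlongrightarrow> F (z / of_real \<gamma>)) (sequentially \<times>\<^sub>F sequentially)"
      using tendsto_uniform_limitI[OF unif[of "cmod (z / of_real \<gamma>)"]] by simp
    then show "((\<lambda>(M, N). \<Sum>k\<in>{- int M..int N}.
          l2_cinner (op_exp (of_real (\<gamma> * of_int k)) hilbert_op a) a' * csinc (z / of_real \<gamma> - of_int k))
        \<longlongrightarrow> l2_cinner (op_exp z hilbert_op a) a') (sequentially \<times>\<^sub>F sequentially)"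
      unfolding P_eq F_eq .
  next
    fix K :: "real set" assume "compact K"
    then obtain D where D: "\<And>t. t \<in> K \<Longrightarrow> \<bar>t\<bar> \<le> D"
      using compact_imp_bounded bounded_real by metis
    have "uniform_limit K (\<lambda>x t. P x (of_real t / of_real \<gamma>)) (\<lambda>t. F (of_real t / of_real \<gamma>))
        (sequentially \<times>\<^sub>F sequentially)"
      by (rule uniform_limit_compose'[OF unif[of "D / \<gamma>"]])
        (use D assms in \<open>auto simp: norm_divide divide_right_mono\<close>)
    then show "uniform_limit K (\<lambda>(M, N) t. \<Sum>k\<in>{- int M..int N}.
          l2_cinner (op_exp (of_real (\<gamma> * of_int k)) hilbert_op a) a' * csinc (of_real t / of_real \<gamma> - of_int k))
        (\<lambda>t. l2_cinner (op_exp (of_real t) hilbert_op a) a') (sequentially \<times>\<^sub>F sequentially)"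
      unfolding P_eq F_eq by (simp add: case_prod_unfold)
  qed
qed

end
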